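(* Let $H$ be a graph on $r$ vertices with $e(H)$ edges and $\Delta_H$ triangles. Let $G$ be a graph on $n$ vertices and let $p\in(0,1)$. Let $\nu\in[\nu_{p,G},1]$ be such that $r\le\log(\nu^{-1})/(12\log(8/p))$ and $\nu^{-2r}\le n$, and write $f=f_{p,G}$, $\mu=\mu_{p,G}$. Then \[\bigg|\frac{t_H(W_G)}{p^{e(H)}}-1-p^{-1}e(H)\,t_{K_2}(f)-p^{-3}\Delta_H\,t_{K_3}(f)\bigg|\le 2^{-2r}\nu^{7/6}+3\binom{r+1}{4}p^{-2}\mu^2.\]
   Context: For a finite set $V$, $\Omega_V$ is $V$ with the uniform probability measure. For a graph $G$, $W_G\colon\Omega_{V(G)}^2\to[0,1]$ is $W_G(x,y)=1$ if $xy\in E(G)$ and $0$ otherwise (so $W_G(x,x)=0$). For $p\in(0,1)$, $f_{p,G}(x,y)=W_G(x,y)-p$, \[\mu_{p,G}=\max_{x\in V(G)}|\mathbb{E}_yf_{p,G}(x,y)|,\qquad \nu_{p,G}=\max_{x\neq y\in V(G)}\max\big(0,\ \mathbb{E}_zf_{p,G}(x,z)f_{p,G}(z,y)\big),\] with $y,z$ uniform on $V(G)$. For a graph $H$ and a bounded symmetric function $W$ on a probability space $\Omega$, $t_H(W)=\int_{\Omega^{V(H)}}\prod_{v_1v_2\in E(H)}W(x_{v_1},x_{v_2})\,d\mathbf{x}$ (product measure). $\Delta_H$ is the number of triangles (subgraphs isomorphic to $K_3$) in $H$. $\log$ is the natural logarithm. *)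

theory Defs
  imports Complex_Main "HOL-Library.FuncSet"
begin

definition simple_graph :: "'a set \<Rightarrow> ('a \<Rightarrow> 'a \<Rightarrow> bool) \<Rightarrow> bool" where
  "simple_graph V E \<longleftrightarrow> finite V \<and> (\<forall>x y. E x y \<longrightarrow> x \<in> V \<and> y \<in> V)
     \<and> (\<forall>x y. E x y \<longrightarrow> E y x) \<and> (\<forall>x. \<not> E x x)"

definition W_graph :: "('a \<Rightarrow> 'a \<Rightarrow> bool) \<Rightarrow> 'a \<Rightarrow> 'a \<Rightarrow> real" where
  "W_graph E x y = (if E x y then 1 else 0)"

definition f_graph :: "real \<Rightarrow> ('a \<Rightarrow> 'a \<Rightarrow> bool) \<Rightarrow> 'a \<Rightarrow> 'a \<Rightarrow> real" where
  "f_graph p E x y = W_graph E x y - p"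

definition avg :: "'a set \<Rightarrow> ('a \<Rightarrow> real) \<Rightarrow> real" where
  "avg V g = (\<Sum>x\<in>V. g x) / real (card V)"

definition mu_graph :: "real \<Rightarrow> 'a set \<Rightarrow> ('a \<Rightarrow> 'a \<Rightarrow> bool) \<Rightarrow> real" where
  "mu_graph p V E = Max ((\<lambda>x. \<bar>avg V (\<lambda>y. f_graph p E x y)\<bar>) ` V)"

text \<open>Maximum over ordered pairs of distinct vertices of max(0, codegree term);
 the extra 0 only matters (as a convention) when |V| = 1.\<close>
definition nu_graph :: "real \<Rightarrow> 'a set \<Rightarrow> ('a \<Rightarrow> 'a \<Rightarrow> bool) \<Rightarrow> real" where
  "nu_graph p V E = Max (insert 0 {max 0 (avg V (\<lambda>z. f_graph p E x z * f_graph p E z y)) | x y.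
       x \<in> V \<and> y \<in> V \<and> x \<noteq> y})"

definition edges_of :: "nat \<Rightarrow> (nat \<Rightarrow> nat \<Rightarrow> bool) \<Rightarrow> (nat \<times> nat) set" where
  "edges_of r EH = {(i, j). i < j \<and> j < r \<and> EH i j}"

definition num_edges :: "nat \<Rightarrow> (nat \<Rightarrow> nat \<Rightarrow> bool) \<Rightarrow> nat" where
  "num_edges r EH = card (edges_of r EH)"

definition num_triangles :: "nat \<Rightarrow> (nat \<Rightarrow> nat \<Rightarrow> bool) \<Rightarrow> nat" where
  "num_triangles r EH = card {(i, j, k). i < j \<and> j < k \<and> k < r \<and> EH i j \<and> EH j k \<and> EH i k}"

definition hom_density :: "nat \<Rightarrow> (nat \<Rightarrow> nat \<Rightarrow> bool) \<Rightarrow> 'a set \<Rightarrow> ('a \<Rightarrow> 'a \<Rightarrow> real) \<Rightarrow> real" where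
  "hom_density r EH V W =
     (\<Sum>\<phi>\<in>{0..<r} \<rightarrow>\<^sub>E V. \<Prod>(i, j)\<in>edges_of r EH. W (\<phi> i) (\<phi> j)) / real (card V) ^ r"

definition complete_graph :: "nat \<Rightarrow> nat \<Rightarrow> bool" where
  "complete_graph i j \<longleftrightarrow> i \<noteq> j"

end

theory Submission
  imports Defs
begin

text \<open>
  Write \<open>W = p + f\<close> and expand \<open>t\<^sub>H(W) / p\<^bsup>e(H)\<^esup>\<close> as the sum of \<open>t\<^sub>F(f) / p\<^bsup>e(F)\<^esup>\<close> over the subgraphs
  \<open>F\<close> of \<open>H\<close>. The empty graph, single edges and triangles give the main terms. If \<open>F\<close> has two
  edges, each of them has a vertex outside the other one; averaging over these two vertices shows
  \<open>|t\<^sub>F(f)| \<le> \<mu>\<^sup>2\<close>, and \<open>H\<close> has at most \<open>3 C(r + 1, 4)\<close> pairs of edges.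

  For the remaining \<open>F\<close>, the codegree \<open>D(x, y) = E\<^sub>z f(x, z) f(y, z)\<close> is only bounded from above, but
  it is positive semidefinite, so its odd moments are nonnegative and all moments of \<open>|D|\<close> of order
  \<open>q < 2 r\<close> are \<open>O(\<nu>\<^sup>q)\<close>. If every vertex of a set \<open>J\<close> has a neighbour outside \<open>J\<close>, the Cauchy--Schwarz
  inequality over the coordinates in \<open>J\<close> and the moment bound give
  \<open>|t\<^sub>F(f)|\<^sup>2 \<le> (1 + 5 r) \<nu>\<^bsup>|J|\<^esup>\<close>. Such a \<open>J\<close> exists that contains at least half of the \<open>v\<close>
  non-isolated vertices of \<open>F\<close>, whence \<open>|t\<^sub>F(f)| \<le> (1 + 5 r) \<nu>\<^bsup>7/6 + v/24\<^esup>\<close> (with a separate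
  argument for paths and cycles on four vertices); the factor
  \<open>\<nu>\<^bsup>v/24\<^esup>\<close> outweighs both \<open>p\<^bsup>-e(F)\<^esup>\<close> and the number of graphs on \<open>v\<close> vertices.
\<close>

section \<open>Averages\<close>

lemma avg_cong: "(\<And>x. x \<in> A \<Longrightarrow> g x = h x) \<Longrightarrow> avg A g = avg A h"
  unfolding avg_def by (simp cong: sum.cong)

lemma avg_add: "avg A (\<lambda>x. g x + h x) = avg A g + avg A h"
  by (simp add: avg_def sum.distrib add_divide_distrib)

lemma avg_diff: "avg A (\<lambda>x. g x - h x) = avg A g - avg A h"
  by (simp add: avg_def sum_subtractf diff_divide_distrib)

lemma avg_cmult: "avg A (\<lambda>x. c * g x) = c * avg A g"
  by (simp add: avg_def sum_distrib_left)

lemma avg_multc: "avg A (\<lambda>x. g x * c) = avg A g * c"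
  by (simp add: avg_def sum_distrib_right)

lemma avg_sum: "avg A (\<lambda>x. \<Sum>k\<in>K. g k x) = (\<Sum>k\<in>K. avg A (g k))"
  unfolding avg_def sum_divide_distrib[symmetric] by (subst sum.swap) simp

lemma avg_swap: "avg A (\<lambda>x. avg B (\<lambda>y. g x y)) = avg B (\<lambda>y. avg A (\<lambda>x. g x y))"
  unfolding avg_def sum_divide_distrib[symmetric]
  by (subst sum.swap) (simp add: mult.commute)

lemma avg_const: "finite A \<Longrightarrow> A \<noteq> {} \<Longrightarrow> avg A (\<lambda>_. c) = c"
  by (simp add: avg_def)

lemma avg_mono: "(\<And>x. x \<in> A \<Longrightarrow> g x \<le> h x) \<Longrightarrow> avg A g \<le> avg A h"
  unfolding avg_def by (intro divide_right_mono sum_mono) auto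

lemma avg_nonneg: "(\<And>x. x \<in> A \<Longrightarrow> 0 \<le> g x) \<Longrightarrow> 0 \<le> avg A g"
  unfolding avg_def by (intro divide_nonneg_nonneg sum_nonneg) auto

lemma avg_le_const:
  assumes "finite A" "A \<noteq> {}" "\<And>x. x \<in> A \<Longrightarrow> g x \<le> c"
  shows "avg A g \<le> c"
  using avg_mono[of A g "\<lambda>_. c"] assms by (simp add: avg_const)

lemma abs_avg_le: "\<bar>avg A g\<bar> \<le> avg A (\<lambda>x. \<bar>g x\<bar>)"
  by (simp add: avg_def abs_divide divide_right_mono)

lemma abs_avg_le_const:
  assumes "finite A" "A \<noteq> {}" "\<And>x. x \<in> A \<Longrightarrow> \<bar>g x\<bar> \<le> c"
  shows "\<bar>avg A g\<bar> \<le> c"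
  using abs_avg_le[of A g] avg_le_const[of A "\<lambda>x. \<bar>g x\<bar>" c] assms by fastforce

lemma avg_mult_avg: "avg A g * avg B h = avg A (\<lambda>x. avg B (\<lambda>y. g x * h y))"
  by (simp add: avg_cmult avg_multc)

text \<open>Expanding the nonnegative variance of \<open>g\<close> gives the inequality.\<close>

lemma avg_square_le:
  assumes "finite A" "A \<noteq> {}"
  shows "(avg A g)\<^sup>2 \<le> avg A (\<lambda>x. (g x)\<^sup>2)"
proof -
  have "0 \<le> avg A (\<lambda>x. (g x - avg A g)\<^sup>2)"
    by (intro avg_nonneg) auto
  also have "\<dots> = avg A (\<lambda>x. ((g x)\<^sup>2 - 2 * avg A g * g x) + (avg A g)\<^sup>2)"
    by (intro avg_cong) (simp add: power2_eq_square algebra_simps)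
  also have "\<dots> = avg A (\<lambda>x. (g x)\<^sup>2) - 2 * avg A g * avg A g + (avg A g)\<^sup>2"
    by (simp only: avg_add avg_diff avg_cmult avg_const[OF assms])
  finally show ?thesis by (simp add: power2_eq_square)
qed

section \<open>Averages over spaces of functions\<close>

lemma avg_PiE_insert:
  assumes "finite S" "i \<notin> S"
  shows "avg (insert i S \<rightarrow>\<^sub>E V) g = avg V (\<lambda>x. avg (S \<rightarrow>\<^sub>E V) (\<lambda>\<phi>. g (\<phi>(i := x))))"
proof -
  have "(\<Sum>\<phi>\<in>insert i S \<rightarrow>\<^sub>E V. g \<phi>) = (\<Sum>x\<in>V. \<Sum>\<phi>\<in>S \<rightarrow>\<^sub>E V. g (\<phi>(i := x)))"
    unfolding PiE_insert_eq using inj_combinator[OF assms(2), of "\<lambda>_. V"]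
    by (subst sum.reindex) (auto simp: sum.cartesian_product case_prod_unfold)
  then show ?thesis
    using assms unfolding avg_def
    by (simp add: card_funcsetE finite_insert sum_divide_distrib[symmetric] mult.commute)
qed

lemma avg_singleton: "avg {a} g = g a"
  by (simp add: avg_def)

text \<open>Fubini for a splitting of the coordinates, moving the elements of \<open>J\<close> one
  at a time.\<close>

lemma avg_PiE_Un:
  assumes "finite I" "finite J" "I \<inter> J = {}"
  shows "avg (I \<union> J \<rightarrow>\<^sub>E V) g =
    avg (I \<rightarrow>\<^sub>E V) (\<lambda>\<beta>. avg (J \<rightarrow>\<^sub>E V) (\<lambda>\<alpha>. g (\<lambda>k. if k \<in> J then \<alpha> k else \<beta> k)))"
  using assms(2,1,3)
proof (induction J arbitrary: g rule: finite_induct)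
  case empty
  then show ?case by (simp add: avg_singleton)
next
  case (insert j J)
  have "avg (I \<union> insert j J \<rightarrow>\<^sub>E V) g
      = avg V (\<lambda>x. avg (I \<union> J \<rightarrow>\<^sub>E V) (\<lambda>\<phi>. g (\<phi>(j := x))))"
    using insert by (subst Un_insert_right, subst avg_PiE_insert) auto
  also have "\<dots> = avg (I \<rightarrow>\<^sub>E V) (\<lambda>\<beta>. avg V (\<lambda>x. avg (J \<rightarrow>\<^sub>E V)
      (\<lambda>\<alpha>. g ((\<lambda>k. if k \<in> J then \<alpha> k else \<beta> k)(j := x)))))"
    using insert by (subst avg_swap) simp
  also have "\<dots> = avg (I \<rightarrow>\<^sub>E V) (\<lambda>\<beta>. avg V (\<lambda>x. avg (J \<rightarrow>\<^sub>E V)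
      (\<lambda>\<alpha>. g (\<lambda>k. if k \<in> insert j J then (\<alpha>(j := x)) k else \<beta> k))))"
    by (intro avg_cong arg_cong[where f = g]) auto
  also have "\<dots> = avg (I \<rightarrow>\<^sub>E V) (\<lambda>\<beta>. avg (insert j J \<rightarrow>\<^sub>E V)
      (\<lambda>\<alpha>. g (\<lambda>k. if k \<in> insert j J then \<alpha> k else \<beta> k)))"
    using insert by (subst avg_PiE_insert) auto
  finally show ?case .
qed

lemma avg_PiE_prod:
  assumes "finite S"
  shows "avg (S \<rightarrow>\<^sub>E V) (\<lambda>\<phi>. \<Prod>i\<in>S. a i (\<phi> i)) = (\<Prod>i\<in>S. avg V (a i))"
  using assms
proof (induction S rule: finite_induct)
  case empty
  then show ?case by (simp add: avg_singleton)
next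
  case (insert j S)
  have "avg (insert j S \<rightarrow>\<^sub>E V) (\<lambda>\<phi>. \<Prod>i\<in>insert j S. a i (\<phi> i))
     = avg V (\<lambda>x. avg (S \<rightarrow>\<^sub>E V) (\<lambda>\<phi>. a j x * (\<Prod>i\<in>S. a i (\<phi> i))))"
    using insert by (subst avg_PiE_insert) (auto intro!: avg_cong prod.cong)
  then show ?case using insert by (simp add: avg_cmult avg_multc)
qed

lemma avg_power:
  "(avg X g) ^ q = avg ({..<q} \<rightarrow>\<^sub>E X) (\<lambda>x. \<Prod>k<q. g (x k))"
  using avg_PiE_prod[of "{..<q}" X "\<lambda>_. g"] by simp

text \<open>The \<open>q\<close>-th power of an average is an average over \<open>q\<close>
  independent points. Interchanging the averages separates \<open>b\<close> from \<open>b'\<close>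
  and leaves a square. This is positive semidefiniteness of Gram kernels, in a form that covers odd
  \<open>q\<close> as well.\<close>

lemma avg_gram_power:
  "avg B (\<lambda>b. avg B (\<lambda>b'. (avg X (\<lambda>x. a x b * a x b')) ^ q))
   = avg ({..<q} \<rightarrow>\<^sub>E X) (\<lambda>x. (avg B (\<lambda>b. \<Prod>k<q. a (x k) b))\<^sup>2)"
  unfolding avg_power[of X] power2_eq_square avg_mult_avg prod.distrib
  by (subst avg_swap[of B "{..<q} \<rightarrow>\<^sub>E X"], subst avg_swap[of B "{..<q} \<rightarrow>\<^sub>E X"]) (rule refl)

section \<open>Moments of codegrees\<close>

text \<open>Having \<open>z\<close> as second argument in both factors displays the codegree as a
  Gram kernel. The diagonal is included, and no smallness is available there.\<close>

definition codeg :: "'a set \<Rightarrow> ('a \<Rightarrow> 'a \<Rightarrow> real) \<Rightarrow> 'a \<Rightarrow> 'a \<Rightarrow> real" where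
  "codeg V f x y = avg V (\<lambda>z. f x z * f y z)"

definition codeg_moment :: "'a set \<Rightarrow> ('a \<Rightarrow> 'a \<Rightarrow> real) \<Rightarrow> nat \<Rightarrow> real" where
  "codeg_moment V f q = avg V (\<lambda>x. avg V (\<lambda>y. \<bar>codeg V f x y\<bar> ^ q))"

lemma prod_abs_le_1:
  fixes c :: "'b \<Rightarrow> real"
  assumes "\<And>i. i \<in> I \<Longrightarrow> \<bar>c i\<bar> \<le> 1"
  shows "\<bar>\<Prod>i\<in>I. c i\<bar> \<le> 1"
  unfolding abs_prod using assms by (intro prod_le_1) auto

lemma prod_abs_le_subset:
  fixes c :: "'b \<Rightarrow> real"
  assumes "finite I" "N \<subseteq> I" "\<And>i. i \<in> I \<Longrightarrow> \<bar>c i\<bar> \<le> 1"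
  shows "\<bar>\<Prod>i\<in>I. c i\<bar> \<le> (\<Prod>i\<in>N. \<bar>c i\<bar>)"
proof -
  have "\<bar>\<Prod>i\<in>I. c i\<bar> = \<bar>\<Prod>i\<in>I - N. c i\<bar> * (\<Prod>i\<in>N. \<bar>c i\<bar>)"
    using prod.subset_diff[OF assms(2,1), of c] by (simp add: abs_mult abs_prod)
  also have "\<dots> \<le> 1 * (\<Prod>i\<in>N. \<bar>c i\<bar>)"
    by (intro mult_right_mono prod_abs_le_1 prod_nonneg) (use assms in auto)
  finally show ?thesis by simp
qed

text \<open>If some factor exceeds 1, the product is at most the \<open>q\<close>-th power of the
  largest factor, which is one of the summands. This takes the place of Hoelder's inequality: a
  mixed moment is reduced to \<open>q\<close>-th moments of single factors, with one
  \<open>q\<close> for all of them.\<close>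

lemma prod_le_sum_powers:
  fixes b :: "'b \<Rightarrow> real"
  assumes "finite J" "\<And>j. j \<in> J \<Longrightarrow> 0 \<le> b j" "card J \<le> q"
  shows "(\<Prod>j\<in>J. b j) \<le> 1 + (\<Sum>j\<in>J. b j ^ q)"
proof (cases "\<forall>j\<in>J. b j \<le> 1")
  case True
  then have "(\<Prod>j\<in>J. b j) \<le> 1" using assms by (intro prod_le_1) auto
  also have "\<dots> \<le> 1 + (\<Sum>j\<in>J. b j ^ q)" using assms by (simp add: sum_nonneg)
  finally show ?thesis .
next
  case False
  define M where "M = Max (b ` J)"
  obtain j0 where j0: "j0 \<in> J" "1 < b j0" using False by force
  have le: "b j \<le> M" if "j \<in> J" for j using that assms by (simp add: M_def)
  have "M \<in> b ` J" unfolding M_def using assms j0 by (intro Max_in) auto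
  then obtain j1 where j1: "j1 \<in> J" "M = b j1" by auto
  have "1 \<le> M" using le[OF j0(1)] j0 by simp
  have "(\<Prod>j\<in>J. b j) \<le> (\<Prod>j\<in>J. M)" using assms le by (intro prod_mono) auto
  also have "\<dots> \<le> M ^ q" using \<open>1 \<le> M\<close> assms by (simp add: power_increasing)
  also have "\<dots> \<le> (\<Sum>j\<in>J. b j ^ q)"
    unfolding j1(2) using assms j1 by (intro member_le_sum) auto
  finally show ?thesis by simp
qed

text \<open>Cauchy--Schwarz over the coordinates in \<open>J\<close>: once the weights \<open>Q\<close> are discarded,
  the coordinates in \<open>J\<close> decouple.\<close>

lemma avg_bipartite_square_le:
  assumes fin: "finite I" "finite J" "finite V" "V \<noteq> {}"
    and P: "\<And>\<beta>. \<bar>P \<beta>\<bar> \<le> 1" and Q: "\<And>\<alpha>. \<bar>Q \<alpha>\<bar> \<le> (1::real)"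
  shows "(avg (I \<rightarrow>\<^sub>E V) (\<lambda>\<beta>. avg (J \<rightarrow>\<^sub>E V) (\<lambda>\<alpha>. P \<beta> * Q \<alpha> * (\<Prod>j\<in>J. a j (\<alpha> j) \<beta>))))\<^sup>2
    \<le> avg (I \<rightarrow>\<^sub>E V) (\<lambda>\<beta>. avg (I \<rightarrow>\<^sub>E V) (\<lambda>\<beta>'. \<Prod>j\<in>J. \<bar>avg V (\<lambda>x. a j x \<beta> * a j x \<beta>')\<bar>))"
proof -
  let ?A = "I \<rightarrow>\<^sub>E V" and ?B = "J \<rightarrow>\<^sub>E V"
  have B: "finite ?B" "?B \<noteq> {}" using fin by (auto simp: finite_PiE PiE_eq_empty_iff)
  define h where "h \<alpha> = avg ?A (\<lambda>\<beta>. P \<beta> * (\<Prod>j\<in>J. a j (\<alpha> j) \<beta>))" for \<alpha>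
  have "avg ?A (\<lambda>\<beta>. avg ?B (\<lambda>\<alpha>. P \<beta> * Q \<alpha> * (\<Prod>j\<in>J. a j (\<alpha> j) \<beta>))) = avg ?B (\<lambda>\<alpha>. Q \<alpha> * h \<alpha>)"
    by (subst avg_swap) (simp add: h_def avg_cmult[symmetric] ac_simps)
  then have "(avg ?A (\<lambda>\<beta>. avg ?B (\<lambda>\<alpha>. P \<beta> * Q \<alpha> * (\<Prod>j\<in>J. a j (\<alpha> j) \<beta>))))\<^sup>2
      \<le> avg ?B (\<lambda>\<alpha>. (Q \<alpha> * h \<alpha>)\<^sup>2)"
    using avg_square_le[OF B, of "\<lambda>\<alpha>. Q \<alpha> * h \<alpha>"] by simp
  also have "\<dots> \<le> avg ?B (\<lambda>\<alpha>. (h \<alpha>)\<^sup>2)"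
  proof (intro avg_mono)
    fix \<alpha>
    have "(Q \<alpha>)\<^sup>2 \<le> 1" using Q[of \<alpha>] by (simp add: abs_square_le_1)
    then show "(Q \<alpha> * h \<alpha>)\<^sup>2 \<le> (h \<alpha>)\<^sup>2"
      by (simp add: power_mult_distrib mult_left_le_one_le)
  qed
  \<comment> \<open>The weight \<open>P\<close> is kept until the average over \<alpha> is taken:
    for fixed \<beta> and \<beta>' the coordinates of \<alpha> are independent, so this average
    factors over \<open>J\<close>.\<close>
  also have "\<dots> = avg ?B (\<lambda>\<alpha>. avg ?A (\<lambda>\<beta>. avg ?A (\<lambda>\<beta>'.
      (P \<beta> * P \<beta>') * (\<Prod>j\<in>J. a j (\<alpha> j) \<beta> * a j (\<alpha> j) \<beta>'))))"
    unfolding h_def power2_eq_square avg_mult_avg prod.distrib by (simp add: ac_simps)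
  also have "\<dots> = avg ?A (\<lambda>\<beta>. avg ?A (\<lambda>\<beta>'. avg ?B (\<lambda>\<alpha>.
      (P \<beta> * P \<beta>') * (\<Prod>j\<in>J. a j (\<alpha> j) \<beta> * a j (\<alpha> j) \<beta>'))))"
    by (subst avg_swap[of ?B], subst avg_swap[of ?B]) (rule refl)
  also have "\<dots> = avg ?A (\<lambda>\<beta>. avg ?A (\<lambda>\<beta>'. (P \<beta> * P \<beta>') *
      (\<Prod>j\<in>J. avg V (\<lambda>x. a j x \<beta> * a j x \<beta>'))))"
    unfolding avg_cmult using fin(2) by (simp add: avg_PiE_prod[where a = "\<lambda>j x. a j x _ * a j x _"])
  also have "\<dots> \<le> avg ?A (\<lambda>\<beta>. avg ?A (\<lambda>\<beta>'. \<Prod>j\<in>J. \<bar>avg V (\<lambda>x. a j x \<beta> * a j x \<beta>')\<bar>))"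
  proof (intro avg_mono)
    fix \<beta> \<beta>'
    let ?x = "\<Prod>j\<in>J. avg V (\<lambda>x. a j x \<beta> * a j x \<beta>')"
    have "\<bar>P \<beta> * P \<beta>'\<bar> \<le> 1 * 1"
      unfolding abs_mult by (intro mult_mono P) auto
    then have "\<bar>P \<beta> * P \<beta>' * ?x\<bar> \<le> \<bar>?x\<bar>"
      unfolding abs_mult[of "P \<beta> * P \<beta>'"] by (intro mult_left_le_one_le) auto
    then show "P \<beta> * P \<beta>' * ?x \<le> (\<Prod>j\<in>J. \<bar>avg V (\<lambda>x. a j x \<beta> * a j x \<beta>')\<bar>)"
      by (simp add: abs_prod)
  qed
  finally show ?thesis .
qed

text \<open>With no weight depending on \<alpha>, the inner average factors for each fixed \<beta>,
  and the triangle inequality suffices.\<close>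

lemma avg_independent_abs_le:
  assumes fin: "finite J" and P: "\<And>\<beta>. \<bar>P \<beta>\<bar> \<le> (1::real)"
  shows "\<bar>avg B (\<lambda>\<beta>. avg (J \<rightarrow>\<^sub>E V) (\<lambda>\<alpha>. P \<beta> * (\<Prod>j\<in>J. a j (\<alpha> j) \<beta>)))\<bar>
    \<le> avg B (\<lambda>\<beta>. \<Prod>j\<in>J. \<bar>avg V (\<lambda>x. a j x \<beta>)\<bar>)"
proof -
  have "avg (J \<rightarrow>\<^sub>E V) (\<lambda>\<alpha>. P \<beta> * (\<Prod>j\<in>J. a j (\<alpha> j) \<beta>)) = P \<beta> * (\<Prod>j\<in>J. avg V (\<lambda>x. a j x \<beta>))" for \<beta>
    unfolding avg_cmult using fin by (simp add: avg_PiE_prod[where a = "\<lambda>j x. a j x _"])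
  then have "\<bar>avg B (\<lambda>\<beta>. avg (J \<rightarrow>\<^sub>E V) (\<lambda>\<alpha>. P \<beta> * (\<Prod>j\<in>J. a j (\<alpha> j) \<beta>)))\<bar>
      \<le> avg B (\<lambda>\<beta>. \<bar>P \<beta> * (\<Prod>j\<in>J. avg V (\<lambda>x. a j x \<beta>))\<bar>)"
    using abs_avg_le by simp
  also have "\<dots> \<le> avg B (\<lambda>\<beta>. \<Prod>j\<in>J. \<bar>avg V (\<lambda>x. a j x \<beta>)\<bar>)"
    using P by (intro avg_mono) (simp add: abs_mult abs_prod mult_left_le_one_le prod_nonneg)
  finally show ?thesis .
qed

section \<open>Moment bounds for symmetric kernels\<close>

locale bounded_kernel =
  fixes V :: "'a set" and f :: "'a \<Rightarrow> 'a \<Rightarrow> real"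
  assumes finite_V: "finite V" and V_nonempty: "V \<noteq> {}"
    and sym: "f x y = f y x" and bounded: "\<bar>f x y\<bar> \<le> 1"
begin

lemma codeg_abs_le_1: "\<bar>codeg V f x y\<bar> \<le> 1"
proof -
  have "\<bar>f x z\<bar> * \<bar>f y z\<bar> \<le> 1 * 1" for z
    using bounded by (intro mult_mono) auto
  then show ?thesis
    unfolding codeg_def by (intro abs_avg_le_const finite_V V_nonempty) (simp add: abs_mult)
qed

text \<open>The right side shows that every moment of the signed codegree is nonnegative, even for
  odd \<open>q\<close>.\<close>

lemma avg_codeg_power_eq:
  "avg V (\<lambda>x. avg V (\<lambda>y. codeg V f x y ^ q))
   = avg ({..<q} \<rightarrow>\<^sub>E V) (\<lambda>x. (avg V (\<lambda>y. \<Prod>k<q. f (x k) y))\<^sup>2)"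
  using avg_gram_power[of V V f q] by (simp add: codeg_def sym)

text \<open>In the application \<open>c i\<close> is \<open>f\<close> if \<open>i\<close> is a leaf
  of a star and 1 otherwise. By the Gram identity the left side is an average of squares of products
  over \<open>I\<close>. All factors but that of the distinguished leaf are at most 1 in absolute
  value; dropping them leaves a moment of ordinary codegrees.\<close>

lemma avg_star_gram_power_le:
  assumes I: "finite I" "i \<in> I" and i: "\<And>x y. c i x y = f x y"
    and c: "\<And>i x y. \<bar>c i x y\<bar> \<le> 1"
  shows "avg (I \<rightarrow>\<^sub>E V) (\<lambda>\<beta>. avg (I \<rightarrow>\<^sub>E V) (\<lambda>\<beta>'.
      avg V (\<lambda>x. (\<Prod>i\<in>I. c i x (\<beta> i)) * (\<Prod>i\<in>I. c i x (\<beta>' i))) ^ q))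
    \<le> codeg_moment V f q"
proof -
  have eq: "avg (I \<rightarrow>\<^sub>E V) (\<lambda>\<beta>. \<Prod>k<q. \<Prod>i\<in>I. c i (x k) (\<beta> i))
      = (\<Prod>i\<in>I. avg V (\<lambda>y. \<Prod>k<q. c i (x k) y))" for x :: "nat \<Rightarrow> 'a"
    using I(1) by (subst prod.swap) (rule avg_PiE_prod)
  have "(\<Prod>i\<in>I. avg V (\<lambda>y. \<Prod>k<q. c i (x k) y))\<^sup>2 \<le> (avg V (\<lambda>y. \<Prod>k<q. f (x k) y))\<^sup>2"
    for x :: "nat \<Rightarrow> 'a"
  proof -
    have "\<bar>\<Prod>i\<in>I. avg V (\<lambda>y. \<Prod>k<q. c i (x k) y)\<bar>
        \<le> (\<Prod>i\<in>{i}. \<bar>avg V (\<lambda>y. \<Prod>k<q. c i (x k) y)\<bar>)"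
      using I c by (intro prod_abs_le_subset abs_avg_le_const prod_abs_le_1 finite_V V_nonempty) auto
    then show ?thesis using i by (simp add: abs_le_square_iff)
  qed
  then have "avg (I \<rightarrow>\<^sub>E V) (\<lambda>\<beta>. avg (I \<rightarrow>\<^sub>E V) (\<lambda>\<beta>'.
      avg V (\<lambda>x. (\<Prod>i\<in>I. c i x (\<beta> i)) * (\<Prod>i\<in>I. c i x (\<beta>' i))) ^ q))
      \<le> avg V (\<lambda>x. avg V (\<lambda>y. codeg V f x y ^ q))"
    unfolding avg_gram_power[where a = "\<lambda>x \<beta>. \<Prod>i\<in>I. c i x (\<beta> i)"] eq avg_codeg_power_eq
    by (intro avg_mono)
  also have "\<dots> \<le> codeg_moment V f q"
    unfolding codeg_moment_def by (intro avg_mono) (metis abs_ge_self power_abs)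
  finally show ?thesis .
qed

text \<open>Squaring doubles the centre \<open>x\<close>; the leaves then average independently,
  each leaf in \<open>N\<close> giving the codegree of the two centres. The other leaves contribute
  factors of absolute value at most 1.\<close>

lemma avg_star_square_le:
  assumes I: "finite I" "N \<subseteq> I" and N: "\<And>i x y. i \<in> N \<Longrightarrow> c i x y = f x y"
    and c: "\<And>i x y. \<bar>c i x y\<bar> \<le> 1"
  shows "avg (I \<rightarrow>\<^sub>E V) (\<lambda>\<beta>. (avg V (\<lambda>x. \<Prod>i\<in>I. c i x (\<beta> i)))\<^sup>2) \<le> codeg_moment V f (card N)"
proof -
  have "avg (I \<rightarrow>\<^sub>E V) (\<lambda>\<beta>. (avg V (\<lambda>x. \<Prod>i\<in>I. c i x (\<beta> i)))\<^sup>2)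
      = avg V (\<lambda>x. avg V (\<lambda>x'. avg (I \<rightarrow>\<^sub>E V) (\<lambda>\<beta>. \<Prod>i\<in>I. c i x (\<beta> i) * c i x' (\<beta> i))))"
    unfolding power2_eq_square avg_mult_avg prod.distrib
    by (subst avg_swap[of "I \<rightarrow>\<^sub>E V"], subst avg_swap[of "I \<rightarrow>\<^sub>E V"]) (rule refl)
  also have "\<dots> = avg V (\<lambda>x. avg V (\<lambda>x'. \<Prod>i\<in>I. avg V (\<lambda>y. c i x y * c i x' y)))"
    using I(1) by (simp add: avg_PiE_prod[where a = "\<lambda>i y. c i _ y * c i _ y"])
  also have "\<dots> \<le> codeg_moment V f (card N)"
    unfolding codeg_moment_def
  proof (intro avg_mono)
    fix x x'
    have "\<bar>c i x y * c i x' y\<bar> \<le> 1 * 1" for i y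
      unfolding abs_mult using c by (intro mult_mono) auto
    then have "\<bar>\<Prod>i\<in>I. avg V (\<lambda>y. c i x y * c i x' y)\<bar> \<le> (\<Prod>i\<in>N. \<bar>avg V (\<lambda>y. c i x y * c i x' y)\<bar>)"
      using I by (intro prod_abs_le_subset abs_avg_le_const finite_V V_nonempty) auto
    also have "\<dots> = \<bar>codeg V f x x'\<bar> ^ card N"
      using N by (simp add: codeg_def)
    finally show "(\<Prod>i\<in>I. avg V (\<lambda>y. c i x y * c i x' y)) \<le> \<bar>codeg V f x x'\<bar> ^ card N" by simp
  qed
  finally show ?thesis .
qed

end

text \<open>The diagonal has weight \<open>1 / card V\<close> in a moment; \<open>card_ge\<close>
  makes it negligible for moments of order up to \<open>R\<close>.\<close>

locale small_codegree = bounded_kernel V f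
  for V :: "'a set" and f :: "'a \<Rightarrow> 'a \<Rightarrow> real" +
  fixes \<nu> :: real and R :: nat
  assumes \<nu>_pos: "0 < \<nu>" and \<nu>_le_1: "\<nu> \<le> 1"
    and codeg_le: "x \<in> V \<Longrightarrow> y \<in> V \<Longrightarrow> x \<noteq> y \<Longrightarrow> codeg V f x y \<le> \<nu>"
    and card_ge: "1 / real (card V) \<le> \<nu> ^ R"
begin

text \<open>The codegree bound is one-sided; for odd \<open>q\<close> the \<open>q\<close>-th moment of the
  codegree is nonnegative, so that its negative part is controlled as well.\<close>

lemma codeg_moment_odd_le:
  assumes "odd q" "q \<le> R"
  shows "codeg_moment V f q \<le> 4 * \<nu> ^ q"
proof -
  let ?D = "codeg V f"
  \<comment> \<open>For odd \<open>q\<close> the power of the absolute value is twice the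
    \<open>q\<close>-th power of the positive part minus the signed power. The positive part is at
    most \<nu> off the diagonal and at most 1 on it.\<close>
  have pointwise: "\<bar>?D x y\<bar> ^ q \<le> 2 * (\<nu> ^ q + (if x = y then 1 else 0)) - ?D x y ^ q"
    if "x \<in> V" "y \<in> V" for x y
  proof (cases "?D x y \<le> 0")
    case True
    then have "\<bar>?D x y\<bar> ^ q = - (?D x y ^ q)" using assms(1) by simp
    then show ?thesis using \<nu>_pos by simp
  next
    case False
    have "?D x y ^ q \<le> \<nu> ^ q + (if x = y then 1 else 0)"
    proof (cases "x = y")
      case True
      have "?D x y ^ q \<le> 1" using False codeg_abs_le_1[of x y] by (intro power_le_one) auto
      then show ?thesis using True \<nu>_pos by (simp add: add_increasing)
    next
      case False
      then show ?thesis using \<open>\<not> ?D x y \<le> 0\<close> codeg_le[OF that] by (simp add: power_mono)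
    qed
    then show ?thesis using False by simp
  qed
  have nonneg: "0 \<le> avg V (\<lambda>x. avg V (\<lambda>y. ?D x y ^ q))"
    unfolding avg_codeg_power_eq by (intro avg_nonneg) auto
  have diag: "avg V (\<lambda>y. if x = y then 1 else 0) = 1 / real (card V)" if "x \<in> V" for x
    using that finite_V by (simp add: avg_def)
  have "codeg_moment V f q
      \<le> avg V (\<lambda>x. avg V (\<lambda>y. 2 * (\<nu> ^ q + (if x = y then 1 else 0)) - ?D x y ^ q))"
    unfolding codeg_moment_def using pointwise by (intro avg_mono)
  also have "\<dots> = avg V (\<lambda>x. 2 * (\<nu> ^ q + avg V (\<lambda>y. if x = y then 1 else 0)))
      - avg V (\<lambda>x. avg V (\<lambda>y. ?D x y ^ q))"
    by (simp add: avg_diff avg_cmult avg_add avg_const[OF finite_V V_nonempty])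
  also have "avg V (\<lambda>x. 2 * (\<nu> ^ q + avg V (\<lambda>y. if x = y then 1 else 0)))
      = avg V (\<lambda>x. 2 * (\<nu> ^ q + 1 / real (card V)))"
    using diag by (intro avg_cong) simp
  also have "\<dots> = 2 * (\<nu> ^ q + 1 / real (card V))"
    by (rule avg_const[OF finite_V V_nonempty])
  also have "\<dots> - avg V (\<lambda>x. avg V (\<lambda>y. ?D x y ^ q)) \<le> 2 * (\<nu> ^ q + \<nu> ^ q)"
    using nonneg card_ge power_decreasing[OF assms(2), of \<nu>] \<nu>_pos \<nu>_le_1 by simp
  finally show ?thesis by simp
qed

text \<open>An even moment is compared with the next odd one: where the codegree exceeds \<nu> in
  absolute value, an additional factor of it divided by \<nu> only increases the power. This uses
  order \<open>q + 1\<close>, hence the strict inequality.\<close>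

lemma codeg_moment_le:
  assumes "q < R"
  shows "codeg_moment V f q \<le> 5 * \<nu> ^ q"
proof (cases "odd q")
  case True
  then show ?thesis using codeg_moment_odd_le[of q] assms \<nu>_pos
    by (smt (verit) less_imp_le zero_less_power)
next
  case False
  let ?D = "codeg V f"
  have pointwise: "\<bar>?D x y\<bar> ^ q \<le> \<nu> ^ q + \<bar>?D x y\<bar> ^ Suc q / \<nu>" for x y
  proof (cases "\<bar>?D x y\<bar> \<le> \<nu>")
    case True
    then have "\<bar>?D x y\<bar> ^ q \<le> \<nu> ^ q" by (intro power_mono) auto
    then show ?thesis using \<nu>_pos by (simp add: add_increasing2)
  next
    case False
    then have "\<bar>?D x y\<bar> ^ q * \<nu> \<le> \<bar>?D x y\<bar> ^ q * \<bar>?D x y\<bar>" by (intro mult_left_mono) auto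
    then have "\<bar>?D x y\<bar> ^ q \<le> \<bar>?D x y\<bar> ^ Suc q / \<nu>" using \<nu>_pos by (simp add: field_simps)
    then show ?thesis using \<nu>_pos by (simp add: add_increasing)
  qed
  have "codeg_moment V f q \<le> avg V (\<lambda>x. avg V (\<lambda>y. \<nu> ^ q + (1 / \<nu>) * \<bar>?D x y\<bar> ^ Suc q))"
    unfolding codeg_moment_def using pointwise by (intro avg_mono) simp
  also have "\<dots> = \<nu> ^ q + (1 / \<nu>) * codeg_moment V f (Suc q)"
    unfolding codeg_moment_def by (simp only: avg_add avg_cmult avg_const[OF finite_V V_nonempty])
  also have "\<dots> \<le> \<nu> ^ q + (1 / \<nu>) * (4 * \<nu> ^ Suc q)"
    using False assms \<nu>_pos by (intro add_left_mono mult_left_mono codeg_moment_odd_le) auto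
  also have "\<dots> = 5 * \<nu> ^ q" using \<nu>_pos by simp
  finally show ?thesis .
qed

end

section \<open>Densities of subgraphs\<close>

definition edge_prod :: "(nat \<times> nat) set \<Rightarrow> ('a \<Rightarrow> 'a \<Rightarrow> real) \<Rightarrow> (nat \<Rightarrow> 'a) \<Rightarrow> real" where
  "edge_prod F f \<phi> = (\<Prod>e\<in>F. f (\<phi> (fst e)) (\<phi> (snd e)))"

text \<open>All \<open>r\<close> coordinates are kept for every edge set, so that different
  subgraphs live on the same space; isolated vertices average out.\<close>

definition sub_density :: "nat \<Rightarrow> (nat \<times> nat) set \<Rightarrow> 'a set \<Rightarrow> ('a \<Rightarrow> 'a \<Rightarrow> real) \<Rightarrow> real" where
  "sub_density r F V f = avg ({0..<r} \<rightarrow>\<^sub>E V) (edge_prod F f)"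

definition adj :: "(nat \<times> nat) set \<Rightarrow> nat \<Rightarrow> nat \<Rightarrow> bool" where
  "adj F i j \<longleftrightarrow> (i, j) \<in> F \<or> (j, i) \<in> F"

definition upper_pairs :: "nat set \<Rightarrow> (nat \<times> nat) set" where
  "upper_pairs S = {(i, j). i \<in> S \<and> j \<in> S \<and> i < j}"

definition verts :: "(nat \<times> nat) set \<Rightarrow> nat set" where
  "verts F = fst ` F \<union> snd ` F"

lemma adj_sym: "adj F i j \<longleftrightarrow> adj F j i"
  by (auto simp: adj_def)

lemma upper_pairs_subset: "upper_pairs S \<subseteq> S \<times> S"
  by (auto simp: upper_pairs_def)

lemma finite_upper_pairs: "finite S \<Longrightarrow> finite (upper_pairs S)"
  using upper_pairs_subset[of S] by (rule finite_subset) simp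

text \<open>The edges are sorted into those outside \<open>J\<close>, those inside \<open>J\<close>
  and those crossing. The crossing edges are grouped by their endpoint in \<open>J\<close>,
  nonadjacent pairs contributing the factor 1. Symmetry of \<open>f\<close> is what permits reading
  a crossing edge from its end in \<open>J\<close>.\<close>

lemma edge_prod_split:
  assumes F: "F \<subseteq> upper_pairs S" and S: "finite S" "J \<subseteq> S" and sym: "\<And>x y. f x y = f y x"
  shows "edge_prod F f \<phi> = edge_prod (F \<inter> (S - J) \<times> (S - J)) f \<phi> * edge_prod (F \<inter> J \<times> J) f \<phi>
    * (\<Prod>j\<in>J. \<Prod>i\<in>S - J. if adj F j i then f (\<phi> j) (\<phi> i) else 1)"
proof -
  let ?I = "S - J" and ?g = "\<lambda>e. f (\<phi> (fst e)) (\<phi> (snd e))"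
  let ?C = "F - ?I \<times> ?I - J \<times> J"
  have finF: "finite F" using finite_subset[OF F finite_upper_pairs[OF S(1)]] .
  have fin: "finite J" "finite ?I" using S finite_subset by auto
  have FS: "a \<in> S \<and> b \<in> S \<and> a < b" if "(a, b) \<in> F" for a b
    using F that by (auto simp: upper_pairs_def)
  have "(\<Prod>j\<in>J. \<Prod>i\<in>?I. if adj F j i then f (\<phi> j) (\<phi> i) else 1)
      = (\<Prod>(j, i)\<in>J \<times> ?I. if adj F j i then f (\<phi> j) (\<phi> i) else 1)"
    by (rule prod.cartesian_product)
  also have "\<dots> = (\<Prod>(j, i)\<in>{(j, i) \<in> J \<times> ?I. adj F j i}. f (\<phi> j) (\<phi> i))"
    using fin by (intro prod.mono_neutral_cong_right) (auto split: if_splits)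
  also have "\<dots> = (\<Prod>e\<in>?C. ?g e)"
  \<comment> \<open>Edges are stored with the smaller endpoint first, crossing pairs with the
    endpoint in \<open>J\<close> first; the bijection translates between these orders.\<close>
  proof (rule prod.reindex_bij_witness[where i = "\<lambda>(a, b). if a \<in> J then (a, b) else (b, a)"
        and j = "\<lambda>(j, i). (min j i, max j i)"])
    fix e assume e: "e \<in> {(j, i) \<in> J \<times> ?I. adj F j i}"
    then obtain j i where ji: "e = (j, i)" "j \<in> J" "i \<in> S" "i \<notin> J" "adj F j i" by auto
    show "(case case e of (j, i) \<Rightarrow> (min j i, max j i) of
        (a, b) \<Rightarrow> if a \<in> J then (a, b) else (b, a)) = e"
      using ji by (auto simp: min_def max_def)
    have "(min j i, max j i) \<in> F" using ji(5) FS by (force simp: adj_def min_def max_def)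
    then show "(case e of (j, i) \<Rightarrow> (min j i, max j i)) \<in> ?C"
      using ji by (auto simp: min_def max_def split: if_splits)
    show "?g (case e of (j, i) \<Rightarrow> (min j i, max j i)) = (case e of (j, i) \<Rightarrow> f (\<phi> j) (\<phi> i))"
      using ji sym by (auto simp: min_def max_def)
  next
    fix e assume e: "e \<in> ?C"
    then obtain a b where ab: "e = (a, b)" "(a, b) \<in> F" by (cases e) auto
    have *: "a \<in> S" "b \<in> S" "a < b" using FS[OF ab(2)] by auto
    show "(case case e of (a, b) \<Rightarrow> if a \<in> J then (a, b) else (b, a) of
        (j, i) \<Rightarrow> (min j i, max j i)) = e"
      using ab * by auto
    show "(case e of (a, b) \<Rightarrow> if a \<in> J then (a, b) else (b, a)) \<in> {(j, i) \<in> J \<times> ?I. adj F j i}"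
      using ab * e by (auto simp: adj_def)
  qed
  finally have cross: "(\<Prod>j\<in>J. \<Prod>i\<in>?I. if adj F j i then f (\<phi> j) (\<phi> i) else 1) = (\<Prod>e\<in>?C. ?g e)" .
  have "F = (F \<inter> ?I \<times> ?I) \<union> (F \<inter> J \<times> J) \<union> ?C" by auto
  then have "(\<Prod>e\<in>F. ?g e) = (\<Prod>e\<in>(F \<inter> ?I \<times> ?I) \<union> (F \<inter> J \<times> J) \<union> ?C. ?g e)" by simp
  also have "\<dots> = (\<Prod>e\<in>F \<inter> ?I \<times> ?I. ?g e) * (\<Prod>e\<in>F \<inter> J \<times> J. ?g e) * (\<Prod>e\<in>?C. ?g e)"
    using finF by (subst prod.union_disjoint, simp, simp, blast, subst prod.union_disjoint) auto
  finally show ?thesis unfolding edge_prod_def cross .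
qed

lemma sub_density_split:
  fixes f :: "'a \<Rightarrow> 'a \<Rightarrow> real"
  assumes F: "F \<subseteq> upper_pairs {0..<r}" and J: "J \<subseteq> {0..<r}" and sym: "\<And>x y. f x y = f y x"
  shows "sub_density r F V f = avg ({0..<r} - J \<rightarrow>\<^sub>E V) (\<lambda>\<beta>. avg (J \<rightarrow>\<^sub>E V) (\<lambda>\<alpha>.
    edge_prod (F \<inter> ({0..<r} - J) \<times> ({0..<r} - J)) f \<beta> * edge_prod (F \<inter> J \<times> J) f \<alpha>
    * (\<Prod>j\<in>J. \<Prod>i\<in>{0..<r} - J. if adj F j i then f (\<alpha> j) (\<beta> i) else 1)))"
proof -
  let ?S = "{0..<r}" and ?m = "\<lambda>\<alpha> \<beta> k. if k \<in> J then \<alpha> k else \<beta> (k::nat) :: 'a"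
  have "finite J" using J finite_subset by auto
  have "sub_density r F V f = avg (?S - J \<rightarrow>\<^sub>E V) (\<lambda>\<beta>. avg (J \<rightarrow>\<^sub>E V) (\<lambda>\<alpha>. edge_prod F f (?m \<alpha> \<beta>)))"
  proof -
    have "(?S - J) \<inter> J = {}" "(?S - J) \<union> J = ?S" using J by auto
    then show ?thesis
      unfolding sub_density_def using \<open>finite J\<close> avg_PiE_Un[of "?S - J" J V "edge_prod F f"] by simp
  qed
  also have "\<dots> = avg (?S - J \<rightarrow>\<^sub>E V) (\<lambda>\<beta>. avg (J \<rightarrow>\<^sub>E V) (\<lambda>\<alpha>.
      edge_prod (F \<inter> (?S - J) \<times> (?S - J)) f \<beta> * edge_prod (F \<inter> J \<times> J) f \<alpha>
      * (\<Prod>j\<in>J. \<Prod>i\<in>?S - J. if adj F j i then f (\<alpha> j) (\<beta> i) else 1)))"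
  proof (intro avg_cong)
    fix \<alpha> \<beta> :: "nat \<Rightarrow> 'a"
    have "edge_prod (F \<inter> (?S - J) \<times> (?S - J)) f (?m \<alpha> \<beta>) = edge_prod (F \<inter> (?S - J) \<times> (?S - J)) f \<beta>"
      unfolding edge_prod_def by (intro prod.cong) auto
    moreover have "edge_prod (F \<inter> J \<times> J) f (?m \<alpha> \<beta>) = edge_prod (F \<inter> J \<times> J) f \<alpha>"
      unfolding edge_prod_def by (intro prod.cong) auto
    moreover have "(\<Prod>j\<in>J. \<Prod>i\<in>?S - J. if adj F j i then f (?m \<alpha> \<beta> j) (?m \<alpha> \<beta> i) else 1)
        = (\<Prod>j\<in>J. \<Prod>i\<in>?S - J. if adj F j i then f (\<alpha> j) (\<beta> i) else 1)"
      by (intro prod.cong) auto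
    ultimately show "edge_prod F f (?m \<alpha> \<beta>) = edge_prod (F \<inter> (?S - J) \<times> (?S - J)) f \<beta>
        * edge_prod (F \<inter> J \<times> J) f \<alpha> * (\<Prod>j\<in>J. \<Prod>i\<in>?S - J. if adj F j i then f (\<alpha> j) (\<beta> i) else 1)"
      using edge_prod_split[OF F _ J, where f = f and \<phi> = "?m \<alpha> \<beta>"] sym by simp
  qed
  finally show ?thesis .
qed

text \<open>The right side does not involve \<open>i\<close> and \<open>j\<close>: each edge of
  \<open>H\<close> contributes the same amount as the single edge on two vertices.\<close>

lemma sub_density_edge:
  assumes "finite V" "V \<noteq> {}" "i < j" "j < r"
  shows "sub_density r {(i, j)} V f = avg V (\<lambda>x. avg V (f x))"
proof -
  define S where "S = {0..<r} - {i, j}"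
  have S: "{0..<r} = insert i (insert j S)" "finite S" "i \<notin> S" "j \<notin> S"
    using assms by (auto simp: S_def)
  have ne: "finite (S \<rightarrow>\<^sub>E V)" "(S \<rightarrow>\<^sub>E V) \<noteq> {}"
    using assms S(2) by (auto simp: finite_PiE PiE_eq_empty_iff)
  show ?thesis
    unfolding sub_density_def edge_prod_def S(1) using assms(3) S avg_const[OF ne]
    by (simp add: avg_PiE_insert)
qed

lemma sub_density_triangle:
  assumes "finite V" "V \<noteq> {}" "i < j" "j < k" "k < r"
  shows "sub_density r {(i, j), (j, k), (i, k)} V f
    = avg V (\<lambda>x. avg V (\<lambda>y. avg V (\<lambda>z. f x y * (f y z * f x z))))"
proof -
  define S where "S = {0..<r} - {i, j, k}"
  have S: "{0..<r} = insert i (insert j (insert k S))" "finite S" "i \<notin> S" "j \<notin> S" "k \<notin> S"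
    using assms by (auto simp: S_def)
  have ne: "finite (S \<rightarrow>\<^sub>E V)" "(S \<rightarrow>\<^sub>E V) \<noteq> {}"
    using assms S(2) by (auto simp: finite_PiE PiE_eq_empty_iff)
  show ?thesis
    unfolding sub_density_def edge_prod_def S(1) using assms(3,4) S avg_const[OF ne]
    by (simp add: avg_PiE_insert)
qed

section \<open>Bounds on subgraph densities by degrees and codegrees\<close>

context bounded_kernel
begin

lemma edge_prod_abs_le_1: "\<bar>edge_prod F f \<phi>\<bar> \<le> 1"
  unfolding edge_prod_def using bounded by (intro prod_abs_le_1)

text \<open>As \<open>a\<close> and \<open>c\<close> are not adjacent, the weight on their two
  coordinates is an empty product, and \<open>avg_independent_abs_le\<close> applies.\<close>

lemma sub_density_independent_pair_le:
  assumes F: "F \<subseteq> upper_pairs {0..<r}" and ac: "a < r" "c < r" "a \<noteq> c" "\<not> adj F a c"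
  defines "D \<equiv> \<lambda>j \<beta>. avg V (\<lambda>x. \<Prod>i\<in>{0..<r} - {a, c}. if adj F j i then f x (\<beta> i) else 1)"
  shows "\<bar>sub_density r F V f\<bar> \<le> avg ({0..<r} - {a, c} \<rightarrow>\<^sub>E V) (\<lambda>\<beta>. \<bar>D a \<beta>\<bar> * \<bar>D c \<beta>\<bar>)"
proof -
  have "F \<inter> {a, c} \<times> {a, c} = {}"
    using F ac(4) by (auto simp: adj_def upper_pairs_def)
  then have "edge_prod (F \<inter> {a, c} \<times> {a, c}) f \<alpha> = 1" for \<alpha> by (simp add: edge_prod_def)
  then show ?thesis
    using sub_density_split[OF F, of "{a, c}" f V] ac sym
      avg_independent_abs_le[of "{a, c}" "edge_prod (F \<inter> ({0..<r} - {a, c}) \<times> ({0..<r} - {a, c})) f"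
        "{0..<r} - {a, c} \<rightarrow>\<^sub>E V" V
        "\<lambda>j x \<beta>. \<Prod>i\<in>{0..<r} - {a, c}. if adj F j i then f x (\<beta> i) else 1", OF _ edge_prod_abs_le_1]
    by (simp add: D_def)
qed

lemma sub_density_two_edges_le:
  assumes F: "F \<subseteq> upper_pairs {0..<r}" "card F = 2" and \<mu>: "\<And>x. x \<in> V \<Longrightarrow> \<bar>avg V (f x)\<bar> \<le> \<mu>"
  shows "\<bar>sub_density r F V f\<bar> \<le> \<mu>\<^sup>2"
proof -
  obtain e e' where "F = {e, e'}" "e \<noteq> e'" using F(2) by (auto simp: card_2_iff)
  then obtain i j k l where ijkl: "F = {(i, j), (k, l)}" "(i, j) \<noteq> (k, l)" by (cases e, cases e') auto
  then have lt: "i < j" "j < r" "k < l" "l < r" using F(1) by (auto simp: upper_pairs_def)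
  \<comment> \<open>Distinct edges share at most one vertex. If they do share one, it is both
    \<open>b\<close> here and \<open>d\<close> below; the estimate treats this case alike.\<close>
  obtain a b where ab: "{a, b} = {i, j}" "a \<notin> {k, l}" "a \<noteq> b"
    using ijkl(2) lt that[of i j] that[of j i] by fastforce
  obtain c d where cd: "{c, d} = {k, l}" "c \<notin> {i, j}" "c \<noteq> d"
    using ijkl(2) lt that[of k l] that[of l k] by fastforce
  have mem: "a < r" "b < r" "c < r" "d < r" "a \<noteq> c" "b \<noteq> c" "d \<noteq> a"
    using ab cd lt by (auto simp: doubleton_eq_iff)
  have adj: "adj F a x \<longleftrightarrow> x = b" "adj F c x \<longleftrightarrow> x = d" for x
    using ab cd unfolding adj_def ijkl(1) by (auto simp: doubleton_eq_iff)
  let ?I = "{0..<r} - {a, c}"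
  have swap: "avg V (\<lambda>x. f x y) = avg V (f y)" for y
    by (intro avg_cong sym)
  have "\<bar>sub_density r F V f\<bar> \<le> avg (?I \<rightarrow>\<^sub>E V) (\<lambda>\<beta>. \<bar>avg V (f (\<beta> b))\<bar> * \<bar>avg V (f (\<beta> d))\<bar>)"
    using sub_density_independent_pair_le[OF F(1), of a c] mem adj ab(3) cd(3) by (simp add: swap)
  also have "\<dots> \<le> \<mu> * \<mu>"
  proof (rule avg_le_const)
    show "finite (?I \<rightarrow>\<^sub>E V)" "?I \<rightarrow>\<^sub>E V \<noteq> {}"
      using finite_V V_nonempty by (auto simp: finite_PiE PiE_eq_empty_iff)
    fix \<beta> assume "\<beta> \<in> ?I \<rightarrow>\<^sub>E V"
    then have "\<beta> b \<in> V" "\<beta> d \<in> V" using mem ab cd by (auto simp: PiE_iff)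
    then show "\<bar>avg V (f (\<beta> b))\<bar> * \<bar>avg V (f (\<beta> d))\<bar> \<le> \<mu> * \<mu>"
      using \<mu>[of "\<beta> b"] by (intro mult_mono \<mu>) auto
  qed
  finally show ?thesis by (simp add: power2_eq_square)
qed

end

context small_codegree
begin

text \<open>Cauchy--Schwarz leaves a product of \<open>card J\<close> generalized codegrees, one for
  each star centred in \<open>J\<close>. After division by \<nu> the product is at most 1 plus the
  \<open>q\<close>-th powers of its factors. Each star has a leaf outside \<open>J\<close>, so the
  average of each such power is at most 5.\<close>

lemma sub_density_square_le:
  assumes F: "F \<subseteq> upper_pairs {0..<r}" and J: "J \<subseteq> {0..<r}" and r: "0 < r" "R = 2 * r"
    and dom: "\<And>j. j \<in> J \<Longrightarrow> \<exists>i\<in>{0..<r} - J. adj F j i"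
  shows "(sub_density r F V f)\<^sup>2 \<le> (1 + 5 * real r) * \<nu> ^ card J"
proof -
  let ?I = "{0..<r} - J"
  let ?a = "\<lambda>j x \<beta>. \<Prod>i\<in>?I. if adj F j i then f x (\<beta> i) else 1"
  let ?D = "\<lambda>j \<beta> \<beta>'. avg V (\<lambda>x. ?a j x \<beta> * ?a j x \<beta>')"
  let ?B = "?I \<rightarrow>\<^sub>E V"
  \<comment> \<open>Three conditions meet here: \<open>q\<close> is even, so that absolute values
    can be removed; \<open>q < R\<close>, so that the moment bound applies; and \<open>q\<close> is
    at least \<open>card J\<close>, since a nonempty \<open>J\<close> misses some vertex.\<close>
  define q where "q = 2 * r - 2"
  have fin: "finite J" using J finite_subset by auto
  have B: "finite ?B" "?B \<noteq> {}" using finite_V V_nonempty by (auto simp: finite_PiE PiE_eq_empty_iff)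
  have Jr: "card J \<le> r" using card_mono[OF _ J] by simp
  have "card J \<le> q"
  proof (cases "J = {}")
    case False
    then have "J \<subset> {0..<r}" using dom J by fastforce
    then have "card J < r" using psubset_card_mono[of "{0..<r}" J] by simp
    then show ?thesis using r unfolding q_def by simp
  qed simp
  have "even q" using r by (simp add: q_def)
  have moment: "avg ?B (\<lambda>\<beta>. avg ?B (\<lambda>\<beta>'. (\<bar>?D j \<beta> \<beta>'\<bar> / \<nu>) ^ q)) \<le> 5" if j: "j \<in> J" for j
  proof -
    obtain i where i: "i \<in> ?I" "adj F j i" using dom[OF j] by blast
    have "avg ?B (\<lambda>\<beta>. avg ?B (\<lambda>\<beta>'. (\<bar>?D j \<beta> \<beta>'\<bar> / \<nu>) ^ q))
        = avg ?B (\<lambda>\<beta>. avg ?B (\<lambda>\<beta>'. (1 / \<nu> ^ q) * ?D j \<beta> \<beta>' ^ q))"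
      by (simp add: power_divide power_even_abs[OF \<open>even q\<close>])
    also have "\<dots> = (1 / \<nu> ^ q) * avg ?B (\<lambda>\<beta>. avg ?B (\<lambda>\<beta>'. ?D j \<beta> \<beta>' ^ q))"
      by (simp only: avg_cmult)
    also have "\<dots> \<le> (1 / \<nu> ^ q) * codeg_moment V f q"
      using i bounded \<nu>_pos
      by (intro mult_left_mono avg_star_gram_power_le[where i = i and c = "\<lambda>i x y. if adj F j i then f x y else 1"]) auto
    also have "\<dots> \<le> (1 / \<nu> ^ q) * (5 * \<nu> ^ q)"
      using r \<nu>_pos by (intro mult_left_mono codeg_moment_le) (auto simp: q_def)
    finally show ?thesis using \<nu>_pos by simp
  qed
  have "(sub_density r F V f)\<^sup>2 \<le> avg ?B (\<lambda>\<beta>. avg ?B (\<lambda>\<beta>'. \<Prod>j\<in>J. \<bar>?D j \<beta> \<beta>'\<bar>))"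
    unfolding sub_density_split[OF F J sym]
    by (intro avg_bipartite_square_le finite_V V_nonempty edge_prod_abs_le_1 fin) auto
  also have "\<dots> \<le> avg ?B (\<lambda>\<beta>. avg ?B (\<lambda>\<beta>'. \<nu> ^ card J * (1 + (\<Sum>j\<in>J. (\<bar>?D j \<beta> \<beta>'\<bar> / \<nu>) ^ q))))"
  proof (intro avg_mono)
    fix \<beta> \<beta>'
    have "(\<Prod>j\<in>J. \<bar>?D j \<beta> \<beta>'\<bar>) = \<nu> ^ card J * (\<Prod>j\<in>J. \<bar>?D j \<beta> \<beta>'\<bar> / \<nu>)"
      using \<nu>_pos by (simp add: prod_dividef)
    also have "\<dots> \<le> \<nu> ^ card J * (1 + (\<Sum>j\<in>J. (\<bar>?D j \<beta> \<beta>'\<bar> / \<nu>) ^ q))"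
      using \<nu>_pos fin \<open>card J \<le> q\<close> by (intro mult_left_mono prod_le_sum_powers) auto
    finally show "(\<Prod>j\<in>J. \<bar>?D j \<beta> \<beta>'\<bar>) \<le> \<nu> ^ card J * (1 + (\<Sum>j\<in>J. (\<bar>?D j \<beta> \<beta>'\<bar> / \<nu>) ^ q))" .
  qed
  also have "\<dots> = \<nu> ^ card J * (1 + (\<Sum>j\<in>J. avg ?B (\<lambda>\<beta>. avg ?B (\<lambda>\<beta>'. (\<bar>?D j \<beta> \<beta>'\<bar> / \<nu>) ^ q))))"
    by (simp only: avg_cmult avg_add avg_sum avg_const[OF B])
  also have "\<dots> \<le> \<nu> ^ card J * (1 + (\<Sum>j\<in>J. 5))"
    using \<nu>_pos moment by (intro mult_left_mono add_left_mono sum_mono) auto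
  also have "\<dots> \<le> \<nu> ^ card J * (1 + 5 * real r)"
    using Jr \<nu>_pos by (intro mult_left_mono) auto
  finally show ?thesis by (simp add: mult.commute)
qed

text \<open>Averaging over the nonadjacent vertices \<open>b\<close> and \<open>d\<close> leaves a
  star with leaves \<open>a\<close>, \<open>c\<close> and one with leaf \<open>c\<close>, whose
  second moments have orders \<open>\<nu> ^ 2\<close> and \<nu>. The vertices \<open>a\<close> and
  \<open>d\<close> may be adjacent, so the cycle is covered too.\<close>

lemma sub_density_path_le:
  assumes F: "F \<subseteq> upper_pairs {0..<r}" and mem: "a < r" "b < r" "c < r" "d < r"
    and dist: "a \<noteq> c" "b \<noteq> d" and path: "adj F b a" "adj F b c" "adj F d c" "\<not> adj F b d"
    and ne: "a \<noteq> b" "a \<noteq> d" "c \<noteq> b" "c \<noteq> d" and R: "2 < R"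
  shows "\<bar>sub_density r F V f\<bar> \<le> 5 * \<nu> powr (3 / 2)"
proof -
  let ?I = "{0..<r} - {b, d}"
  let ?D = "\<lambda>j \<beta>. avg V (\<lambda>x. \<Prod>i\<in>?I. if adj F j i then f x (\<beta> i) else 1)"
  have card_ac: "card {a, c} = 2" using dist by simp
  have sq: "(\<nu> powr s)\<^sup>2 = \<nu> powr (2 * s)" for s
    by (simp add: power2_eq_square powr_add[symmetric])
  have "\<bar>sub_density r F V f\<bar> \<le> avg (?I \<rightarrow>\<^sub>E V) (\<lambda>\<beta>. \<bar>?D b \<beta>\<bar> * \<bar>?D d \<beta>\<bar>)"
    using sub_density_independent_pair_le[OF F, of b d] mem dist path by simp
  \<comment> \<open>The weights in this arithmetic-geometric mean inequality make both terms of
    order \<open>\<nu> powr (3 / 2)\<close>.\<close>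
  also have "\<dots> \<le> avg (?I \<rightarrow>\<^sub>E V) (\<lambda>\<beta>. \<nu> powr (- 1 / 2) / 2 * (?D b \<beta>)\<^sup>2 + \<nu> powr (1 / 2) / 2 * (?D d \<beta>)\<^sup>2)"
  proof (intro avg_mono)
    fix \<beta>
    let ?u = "\<nu> powr (- 1 / 4) * \<bar>?D b \<beta>\<bar>" and ?v = "\<nu> powr (1 / 4) * \<bar>?D d \<beta>\<bar>"
    have "\<bar>?D b \<beta>\<bar> * \<bar>?D d \<beta>\<bar> = ?u * ?v"
      using \<nu>_pos by (simp add: powr_minus field_simps)
    also have "\<dots> \<le> (?u\<^sup>2 + ?v\<^sup>2) / 2" using sum_squares_bound[of ?u ?v] by simp
    also have "\<dots> = \<nu> powr (- 1 / 2) / 2 * (?D b \<beta>)\<^sup>2 + \<nu> powr (1 / 2) / 2 * (?D d \<beta>)\<^sup>2"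
      by (simp add: power_mult_distrib sq add_divide_distrib)
    finally show "\<bar>?D b \<beta>\<bar> * \<bar>?D d \<beta>\<bar>
      \<le> \<nu> powr (- 1 / 2) / 2 * (?D b \<beta>)\<^sup>2 + \<nu> powr (1 / 2) / 2 * (?D d \<beta>)\<^sup>2" .
  qed
  also have "\<dots> = \<nu> powr (- 1 / 2) / 2 * avg (?I \<rightarrow>\<^sub>E V) (\<lambda>\<beta>. (?D b \<beta>)\<^sup>2)
      + \<nu> powr (1 / 2) / 2 * avg (?I \<rightarrow>\<^sub>E V) (\<lambda>\<beta>. (?D d \<beta>)\<^sup>2)"
    by (simp only: avg_add avg_cmult)
  also have "\<dots> \<le> \<nu> powr (- 1 / 2) / 2 * codeg_moment V f (card {a, c})
      + \<nu> powr (1 / 2) / 2 * codeg_moment V f (card {c})"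
  proof (intro add_mono mult_left_mono)
    show "avg (?I \<rightarrow>\<^sub>E V) (\<lambda>\<beta>. (?D b \<beta>)\<^sup>2) \<le> codeg_moment V f (card {a, c})"
      using bounded path mem dist ne
      by (intro avg_star_square_le[where c = "\<lambda>i x y. if adj F b i then f x y else 1"]) auto
    show "avg (?I \<rightarrow>\<^sub>E V) (\<lambda>\<beta>. (?D d \<beta>)\<^sup>2) \<le> codeg_moment V f (card {c})"
      using bounded path mem dist ne
      by (intro avg_star_square_le[where c = "\<lambda>i x y. if adj F d i then f x y else 1"]) auto
  qed auto
  also have "\<dots> \<le> \<nu> powr (- 1 / 2) / 2 * (5 * \<nu> ^ 2) + \<nu> powr (1 / 2) / 2 * (5 * \<nu> ^ 1)"
    unfolding card_ac using codeg_moment_le[of 2] codeg_moment_le[of 1] R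
    by (intro add_mono mult_left_mono) auto
  also have "\<dots> = 5 * \<nu> powr (3 / 2)"
  proof -
    have "\<nu> powr (- 1 / 2) * \<nu> ^ 2 = \<nu> powr (- 1 / 2 + 2)"
      using \<nu>_pos by (simp only: powr_add) (simp add: powr_numeral)
    moreover have "\<nu> powr (1 / 2) * \<nu> = \<nu> powr (1 / 2 + 1)"
      using \<nu>_pos by (simp only: powr_add) simp
    ultimately show ?thesis by (simp add: algebra_simps)
  qed
  finally show ?thesis .
qed

end

section \<open>Large dominated vertex sets\<close>

lemma mem_verts_iff: "i \<in> verts F \<longleftrightarrow> (\<exists>j. adj F i j)"
  by (force simp: verts_def adj_def)

lemma verts_subset: "F \<subseteq> upper_pairs S \<Longrightarrow> verts F \<subseteq> S"
  by (auto simp: verts_def upper_pairs_def)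

lemma subset_upper_pairs_verts: "F \<subseteq> upper_pairs S \<Longrightarrow> F \<subseteq> upper_pairs (verts F)"
  by (force simp: verts_def upper_pairs_def)

lemma card_upper_pairs:
  assumes "finite S"
  shows "card (upper_pairs S) = card S choose 2"
proof -
  have "bij_betw (\<lambda>(i, j). {i, j}) (upper_pairs S) {K. K \<subseteq> S \<and> card K = 2}"
  proof (intro bij_betw_imageI)
    show "inj_on (\<lambda>(i, j). {i, j}) (upper_pairs S)"
      by (auto simp: inj_on_def upper_pairs_def doubleton_eq_iff)
    show "(\<lambda>(i, j). {i, j}) ` upper_pairs S = {K. K \<subseteq> S \<and> card K = 2}"
    proof (intro equalityI subsetI)
      fix K assume "K \<in> {K. K \<subseteq> S \<and> card K = 2}"
      then obtain x y where "K = {x, y}" "x \<noteq> y" "x \<in> S" "y \<in> S" by (auto simp: card_2_iff)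
      then have "K = (\<lambda>(i, j). {i, j}) (min x y, max x y)" "(min x y, max x y) \<in> upper_pairs S"
        by (auto simp: upper_pairs_def min_def max_def)
      then show "K \<in> (\<lambda>(i, j). {i, j}) ` upper_pairs S" by blast
    qed (auto simp: upper_pairs_def)
  qed
  then show ?thesis using bij_betw_same_card n_subsets[OF assms, of 2] by fastforce
qed

text \<open>Two vertices carry at most one edge, so three edges force three vertices; those have
  only three pairs, all of which are then edges.\<close>

lemma triangle_of_card:
  assumes F: "F \<subseteq> upper_pairs S" and "finite S" and card: "3 \<le> card F" "card (verts F) \<le> 3"
  shows "\<exists>i j k. i < j \<and> j < k \<and> F = {(i, j), (j, k), (i, k)}"
proof -
  have fin: "finite (verts F)" using verts_subset[OF F] assms(2) by (rule finite_subset)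
  have sub: "F \<subseteq> upper_pairs (verts F)" using F by (rule subset_upper_pairs_verts)
  have le: "card F \<le> card (verts F) choose 2"
    using card_mono[OF finite_upper_pairs[OF fin] sub] card_upper_pairs[OF fin] by simp
  have three: "card (verts F) = 3"
  proof (rule ccontr)
    assume "card (verts F) \<noteq> 3"
    then have "card (verts F) \<in> {0, 1, 2}" using card(2) by auto
    then show False using le card(1) by (auto simp: binomial_eq_0)
  qed
  then obtain x y z where "verts F = {x, y, z}" "x \<noteq> y" "y \<noteq> z" "x \<noteq> z"
    by (auto simp: card_3_iff)
  then obtain i j k where ijk: "verts F = {i, j, k}" "i < j" "j < k"
    by (metis insert_commute linorder_neqE_nat)
  have "card (verts F) choose 2 = 3" using three by (simp add: numeral_eq_Suc)
  then have "F = upper_pairs (verts F)"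
    using card(1) le card_upper_pairs[OF fin] by (intro card_subset_eq finite_upper_pairs fin sub) simp
  also have "\<dots> = {(i, j), (j, k), (i, k)}"
    unfolding ijk(1) using ijk(2,3) by (auto simp: upper_pairs_def)
  finally have "i < j \<and> j < k \<and> F = {(i, j), (j, k), (i, k)}" using ijk(2,3) by simp
  then show ?thesis by (intro exI)
qed

text \<open>Among the sets all of whose members have a neighbour outside the set, one of maximal
  size has a complement of the same kind.\<close>

lemma ex_large_dominated:
  assumes fin: "finite (verts F)" and irrefl: "\<And>i. \<not> adj F i i"
  obtains J where "J \<subseteq> verts F" "\<And>j. j \<in> J \<Longrightarrow> \<exists>i\<in>verts F - J. adj F j i"
    "card (verts F) \<le> 2 * card J"
proof -
  let ?U = "verts F"
  define valid where "valid J \<longleftrightarrow> J \<subseteq> ?U \<and> (\<forall>j\<in>J. \<exists>i\<in>?U - J. adj F j i)" for J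
  have "valid {}" by (simp add: valid_def)
  moreover have "\<forall>J. valid J \<longrightarrow> card J < Suc (card ?U)"
    using fin by (auto simp: valid_def less_Suc_eq_le intro: card_mono)
  ultimately obtain J where J: "valid J" "\<And>K. valid K \<Longrightarrow> card K \<le> card J"
    using ex_has_greatest_nat[of valid "{}" card] by blast
  have JU: "J \<subseteq> ?U" and finJ: "finite J" using J(1) fin finite_subset by (auto simp: valid_def)
  have "valid (?U - J)"
  proof (rule ccontr)
    \<comment> \<open>A vertex \<open>i\<close> outside \<open>J\<close> without neighbours in
      \<open>J\<close> could be added to \<open>J\<close>: its own neighbours are outside, and no
      member of \<open>J\<close> relies on \<open>i\<close>. This contradicts maximality.\<close>
    assume "\<not> valid (?U - J)"
    then obtain i where i: "i \<in> ?U" "i \<notin> J" "\<And>k. k \<in> J \<Longrightarrow> \<not> adj F i k"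
      using JU by (auto simp: valid_def)
    obtain k where "adj F i k" using i(1) by (auto simp: mem_verts_iff)
    then have k: "k \<in> ?U - insert i J" "adj F i k"
      using i irrefl by (auto simp: mem_verts_iff adj_sym[of F k])
    have "valid (insert i J)"
      unfolding valid_def
    proof (intro conjI ballI)
      show "insert i J \<subseteq> ?U" using i(1) JU by simp
      fix j assume "j \<in> insert i J"
      then show "\<exists>i'\<in>?U - insert i J. adj F j i'"
      proof
        assume "j \<in> J"
        then obtain i' where "i' \<in> ?U - J" "adj F j i'" using J(1) by (auto simp: valid_def)
        moreover have "i' \<noteq> i" using i(3)[OF \<open>j \<in> J\<close>] calculation(2) by (auto simp: adj_sym)
        ultimately show ?thesis by blast
      qed (use k in blast)
    qed
    then show False using J(2)[of "insert i J"] i(2) finJ by simp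
  qed
  then have "card ?U - card J \<le> card J"
    using J(2)[of "?U - J"] JU finJ by (simp add: card_Diff_subset)
  then show thesis using J(1) that[of J] by (auto simp: valid_def)
qed

text \<open>Three edges cannot form a matching on four vertices, so some \<open>b\<close> has two
  neighbours \<open>a\<close> and \<open>c\<close>. The fourth vertex is adjacent to
  \<open>b\<close>, giving a spanning star, or else to \<open>a\<close> or \<open>c\<close>, giving
  a path.\<close>

lemma four_vertices_star_or_path:
  assumes F: "F \<subseteq> upper_pairs S" and "finite S" and card: "3 \<le> card F" "card (verts F) = 4"
  obtains (star) b where "b \<in> verts F" "\<And>j. j \<in> verts F - {b} \<Longrightarrow> adj F j b"
  | (path) a b c d where "distinct [a, b, c, d]" "{a, b, c, d} = verts F"
      "adj F b a" "adj F b c" "adj F d c" "\<not> adj F b d"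
proof -
  have irrefl: "\<not> adj F i i" for i using F by (auto simp: adj_def upper_pairs_def)
  have finF: "finite F" using finite_subset[OF F finite_upper_pairs[OF assms(2)]] .
  have "\<exists>b a c. a \<noteq> c \<and> adj F b a \<and> adj F b c"
  proof (rule ccontr)
    \<comment> \<open>In a matching the first and second endpoints are all distinct, so there would
      be at least six vertices.\<close>
    assume "\<not> ?thesis"
    then have uniq: "a = c" if "adj F b a" "adj F b c" for a b c using that by blast
    have lt: "i < j" if "(i, j) \<in> F" for i j using F that by (auto simp: upper_pairs_def)
    have "inj_on fst F" "inj_on snd F"
      using uniq by (auto simp: inj_on_def adj_def) blast+
    moreover have "fst ` F \<inter> snd ` F = {}"
    proof (rule ccontr)
      assume "fst ` F \<inter> snd ` F \<noteq> {}"
      then obtain i j k where ijk: "(i, j) \<in> F" "(k, i) \<in> F" by auto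
      then have "j = k" using uniq[of i j k] by (auto simp: adj_def)
      then show False using lt[OF ijk(1)] lt[OF ijk(2)] by simp
    qed
    ultimately have "card (verts F) = 2 * card F"
      unfolding verts_def using finF by (simp add: card_Un_disjoint card_image)
    then show False using card by simp
  qed
  then obtain b a c where bac: "a \<noteq> c" "adj F b a" "adj F b c" by blast
  have ne: "a \<noteq> b" "c \<noteq> b" using bac irrefl by auto
  have mem: "{a, b, c} \<subseteq> verts F" using bac adj_sym by (auto simp: mem_verts_iff)
  have "card (verts F - {a, b, c}) = 1"
    using card_Diff_subset[OF _ mem] bac(1) ne card(2) by simp
  then obtain d where d: "verts F - {a, b, c} = {d}" by (rule card_1_singletonE)
  then have U: "verts F = {a, b, c, d}" "d \<notin> {a, b, c}" using mem by auto
  show thesis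
  proof (cases "adj F b d")
    case True
    then show ?thesis using star[of b] U bac by (auto simp: adj_sym[of F _ b])
  next
    case False
    have "d \<in> verts F" using U by simp
    then obtain x where "adj F d x" by (auto simp: mem_verts_iff)
    moreover have "x \<in> verts F" using calculation by (auto simp: mem_verts_iff adj_sym[of F x])
    ultimately have "adj F d a \<or> adj F d c"
      using U(1) False irrefl by (auto simp: adj_sym[of F d b])
    then show ?thesis
    proof
      assume "adj F d a"
      then show ?thesis using path[of c b a d] U bac ne False by auto
    next
      assume "adj F d c"
      then show ?thesis using path[of a b c d] U bac ne False by auto
    qed
  qed
qed

context small_codegree
begin

text \<open>The square root of \<open>sub_density_square_le\<close>, with the constant left unrooted
  for simplicity.\<close>

lemma sub_density_abs_le_of_dominated:
  assumes F: "F \<subseteq> upper_pairs {0..<r}" and J: "J \<subseteq> verts F" and r: "0 < r" "R = 2 * r"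
    and dom: "\<And>j. j \<in> J \<Longrightarrow> \<exists>i\<in>verts F - J. adj F j i" and s: "2 * s \<le> real (card J)"
  shows "\<bar>sub_density r F V f\<bar> \<le> (1 + 5 * real r) * \<nu> powr s"
proof -
  have sub: "verts F \<subseteq> {0..<r}" using F by (rule verts_subset)
  have "(sub_density r F V f)\<^sup>2 \<le> (1 + 5 * real r) * \<nu> ^ card J"
    using sub J dom by (intro sub_density_square_le F r) blast+
  also have "\<dots> \<le> (1 + 5 * real r)\<^sup>2 * \<nu> powr (2 * s)"
  proof (intro mult_mono)
    show "\<nu> ^ card J \<le> \<nu> powr (2 * s)"
      using s \<nu>_pos \<nu>_le_1 powr_mono'[OF s, of \<nu>] by (simp add: powr_realpow)
  qed (use \<nu>_pos in \<open>auto simp: power2_eq_square algebra_simps\<close>)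
  also have "\<dots> = ((1 + 5 * real r) * \<nu> powr s)\<^sup>2"
    by (simp add: power_mult_distrib power2_eq_square[of "\<nu> powr s"] powr_add[symmetric])
  finally show ?thesis unfolding abs_le_square_iff[symmetric] by (simp add: abs_mult)
qed

lemma sub_density_abs_le:
  assumes F: "F \<subseteq> upper_pairs {0..<r}" and R: "R = 2 * r"
    and card: "3 \<le> card F" "4 \<le> card (verts F)"
  shows "\<bar>sub_density r F V f\<bar> \<le> (1 + 5 * real r) * \<nu> powr (7 / 6 + real (card (verts F)) / 24)"
proof -
  have sub: "verts F \<subseteq> {0..<r}" using F by (rule verts_subset)
  have fin: "finite (verts F)" using sub by (rule finite_subset) simp
  have r: "4 \<le> r" using card_mono[OF _ sub] card(2) by simp
  have irrefl: "\<not> adj F i i" for i using F by (auto simp: adj_def upper_pairs_def)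
  show ?thesis
  proof (cases "card (verts F) = 4")
    case False
    obtain J where J: "J \<subseteq> verts F" "\<And>j. j \<in> J \<Longrightarrow> \<exists>i\<in>verts F - J. adj F j i"
      "card (verts F) \<le> 2 * card J"
      using ex_large_dominated[OF fin irrefl] by metis
    \<comment> \<open>This is the required exponent bound,
      \<open>2 * (7 / 6 + v / 24) \<le> card J\<close>, multiplied by 12. With five vertices,
      rounding up to \<open>card J \<ge> 3\<close> is essential; with four vertices and
      \<open>card J = 2\<close> it fails.\<close>
    have "12 * card J \<ge> 28 + card (verts F)" using J(3) False card(2) by presburger
    then show ?thesis
      using r by (intro sub_density_abs_le_of_dominated[OF F J(1) _ R J(2)]) auto
  next
    case four: True
    text \<open>For the path and the cycle on four vertices dominated sets only yield the exponent 1.\<close>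
    show ?thesis
    proof (rule four_vertices_star_or_path[OF F finite_atLeastLessThan card(1) four])
      fix b assume star: "b \<in> verts F" "\<And>j. j \<in> verts F - {b} \<Longrightarrow> adj F j b"
      have "card (verts F - {b}) = 3" using star(1) four fin by simp
      then show ?thesis
        using r star four
        by (intro sub_density_abs_le_of_dominated[OF F, of "verts F - {b}"] R) auto
    next
      fix a b c d
      assume path: "distinct [a, b, c, d]" "{a, b, c, d} = verts F"
        "adj F b a" "adj F b c" "adj F d c" "\<not> adj F b d"
      have "a < r" "b < r" "c < r" "d < r" using path(2) sub by auto
      then have "\<bar>sub_density r F V f\<bar> \<le> 5 * \<nu> powr (3 / 2)"
        using path r R by (intro sub_density_path_le[OF F, of a b c d]) auto
      \<comment> \<open>For four vertices the exponent on the right is 4/3, which is below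
        3/2.\<close>
      also have "\<dots> \<le> (1 + 5 * real r) * \<nu> powr (7 / 6 + real (card (verts F)) / 24)"
        using r \<nu>_pos \<nu>_le_1 four by (intro mult_mono powr_mono') auto
      finally show ?thesis .
    qed
  qed
qed

end

section \<open>Summation over subgraphs\<close>

lemma real_choose_two: "real (n choose 2) = real n * (real n - 1) / 2"
proof (induction n)
  case (Suc n)
  have "Suc n choose 2 = n + (n choose 2)" by (simp add: numeral_2_eq_2)
  then show ?case using Suc by (simp add: field_simps)
qed (simp add: binomial_eq_0)

text \<open>The left side counts pairs of possible edges. Both sides are compared as polynomials in
  \<open>r\<close>.\<close>

lemma choose_two_choose_two: "(r choose 2) choose 2 = 3 * ((r + 1) choose 4)"
proof -
  have three: "real (n choose 3) = real n * (real n - 1) * (real n - 2) / 6" for n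
  proof (induction n)
    case (Suc n)
    have "Suc n choose 3 = (n choose 2) + (n choose 3)" by (simp add: numeral_eq_Suc)
    then show ?case using Suc by (simp add: real_choose_two field_simps)
  qed (simp add: binomial_eq_0)
  have four: "real (n choose 4) = real n * (real n - 1) * (real n - 2) * (real n - 3) / 24" for n
  proof (induction n)
    case (Suc n)
    have "Suc n choose 4 = (n choose 3) + (n choose 4)" by (simp add: numeral_eq_Suc)
    then show ?case using Suc by (simp add: three field_simps)
  qed (simp add: binomial_eq_0)
  have "real ((r choose 2) choose 2) = real (3 * ((r + 1) choose 4))"
    unfolding of_nat_mult by (simp add: real_choose_two four field_simps)
  then show ?thesis by (simp only: of_nat_eq_iff)
qed

lemma five_mult_le_two_power: "1 + 5 * real r \<le> 4 * 2 ^ r"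
proof (induction r)
  case (Suc r)
  show ?case
  proof (cases "r \<le> 0")
    case False
    then have "(2::real) ^ 1 \<le> 2 ^ r" by (intro power_increasing) auto
    then show ?thesis using Suc by simp
  qed simp
qed simp

text \<open>The hypothesis \<open>r \<le> log(1/\<nu>) / (12 log(8/p))\<close> pays for the number of graphs on \<open>u\<close>
  vertices and for the powers of \<open>p\<close> in the denominators out of \<open>\<nu>\<close> to the power \<open>u/24\<close>.\<close>

lemma graph_weight_le:
  assumes p: "0 < p" "p < 1" and \<nu>: "0 < \<nu>" "\<nu> \<le> (p / 8) powr (12 * real r)"
    and u: "4 \<le> u" "u \<le> r"
  shows "(2 / p) ^ (u choose 2) * \<nu> powr (real u / 24) \<le> 2 powr (- 4 * real r) / 4"
proof -
  \<comment> \<open>Since \<open>p / 8 = x / 4\<close>, the bound on \<nu> splits into a power of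
    \<open>x\<close>, which pays for \<open>2 / p = 1 / x\<close>, and a power of 1/4, which
    supplies \<open>2 powr (- 4 * real r)\<close>.\<close>
  define x where "x = p / 2"
  have x: "0 < x" "x \<le> 1 / 2" using p by (auto simp: x_def)
  have x8: "p / 8 = x * (1 / 4)" "2 / p = 1 / x" using p by (auto simp: x_def)
  have "\<nu> powr (real u / 24) \<le> ((p / 8) powr (12 * real r)) powr (real u / 24)"
    using \<nu> by (intro powr_mono2) auto
  also have "\<dots> = x powr (real r * real u / 2) * (1 / 4) powr (real r * real u / 2)"
    unfolding powr_powr x8(1) using x by (subst powr_mult) auto
  finally have 1: "\<nu> powr (real u / 24) \<le> x powr (real r * real u / 2) * (1 / 4) powr (real r * real u / 2)" .
  have 2: "(2 / p) ^ (u choose 2) = x powr (- (real u * (real u - 1) / 2))"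
    unfolding x8(2) using x powr_realpow[of x "u choose 2"]
    by (simp add: powr_minus power_divide real_choose_two inverse_eq_divide)
  have "(2 / p) ^ (u choose 2) * \<nu> powr (real u / 24)
      \<le> x powr (- (real u * (real u - 1) / 2)) * (x powr (real r * real u / 2) * (1 / 4) powr (real r * real u / 2))"
    unfolding 2 using 1 by (intro mult_left_mono) auto
  also have "\<dots> = x powr (real u * (real r - real u + 1) / 2) * (1 / 4) powr (real r * real u / 2)"
    unfolding mult.assoc[symmetric] powr_add[symmetric] by (simp add: field_simps)
  also have "\<dots> \<le> 1 / 4 * 2 powr (- 4 * real r)"
  proof (intro mult_mono)
    \<comment> \<open>After paying for the edges, \<open>x\<close> still has exponent at least 2; as
      \<open>x \<le> 1 / 2\<close>, this yields the additional factor 1/4.\<close>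
    have "4 * 1 \<le> real u * (real r - real u + 1)" using u by (intro mult_mono) auto
    then have "x powr (real u * (real r - real u + 1) / 2) \<le> x powr 2"
      using x by (intro powr_mono') auto
    also have "\<dots> \<le> (1 / 2) powr 2" using x by (intro powr_mono2) auto
    finally show "x powr (real u * (real r - real u + 1) / 2) \<le> 1 / 4"
      by (simp add: power2_eq_square)
    have "real r * 4 \<le> real r * real u" using u by (intro mult_left_mono) auto
    then have "(1 / 4 :: real) powr (real r * real u / 2) \<le> (1 / 4) powr (2 * real r)"
      by (intro powr_mono') auto
    also have "(1 / 4 :: real) powr (2 * real r) = (2 powr (- 2)) powr (2 * real r)"
      by (simp add: powr_minus)
    also have "\<dots> = 2 powr (- 4 * real r)"
      unfolding powr_powr by simp
    finally show "(1 / 4 :: real) powr (real r * real u / 2) \<le> 2 powr (- 4 * real r)" .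
  qed auto
  finally show ?thesis by simp
qed

section \<open>Expansion over edge subsets\<close>

lemma hom_density_eq_sub_density:
  "hom_density r EH V W = sub_density r (edges_of r EH) V W"
  by (simp add: hom_density_def sub_density_def edge_prod_def avg_def card_funcsetE case_prod_unfold)

lemma edges_of_subset: "edges_of r EH \<subseteq> upper_pairs {0..<r}"
  by (auto simp: edges_of_def upper_pairs_def)

lemma sub_density_shift:
  assumes "finite F" "p \<noteq> 0"
  shows "sub_density r F V (\<lambda>x y. f x y + p) / p ^ card F
    = (\<Sum>A\<in>Pow F. sub_density r A V f / p ^ card A)"
proof -
  have "edge_prod F (\<lambda>x y. f x y + p) \<phi> = (\<Sum>A\<in>Pow F. p ^ card (F - A) * edge_prod A f \<phi>)" for \<phi>
    unfolding edge_prod_def using assms(1) by (subst prod_add) (auto simp: mult.commute)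
  then have "sub_density r F V (\<lambda>x y. f x y + p) = (\<Sum>A\<in>Pow F. p ^ card (F - A) * sub_density r A V f)"
    unfolding sub_density_def avg_cmult[symmetric] avg_sum[symmetric] by (intro avg_cong)
  also have "\<dots> / p ^ card F = (\<Sum>A\<in>Pow F. sub_density r A V f / p ^ card A)"
    unfolding sum_divide_distrib
  proof (intro sum.cong refl)
    fix A assume "A \<in> Pow F"
    then have "card F = card (F - A) + card A"
      using assms(1) by (metis PowD add.commute card_Diff_subset card_mono finite_subset le_add_diff_inverse)
    then show "p ^ card (F - A) * sub_density r A V f / p ^ card F = sub_density r A V f / p ^ card A"
      using assms(2) by (simp add: power_add)
  qed
  finally show ?thesis .
qed

text \<open>The expansion is indexed by edge sets, while triangles are counted as increasing
  triples; such a triple can be recovered from its edge set.\<close>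

lemma num_triangles_eq:
  "num_triangles r EH
    = card {F \<in> Pow (edges_of r EH). \<exists>i j k. i < j \<and> j < k \<and> F = {(i, j), (j, k), (i, k)}}"
proof -
  let ?T = "{(i, j, k). i < j \<and> j < k \<and> k < r \<and> EH i j \<and> EH j k \<and> EH i k}"
  let ?g = "\<lambda>(i, j, k). {(i, j), (j, k), (i, k)}"
  have "inj_on ?g ?T"
  proof (rule inj_onI, clarsimp)
    fix i j k i' j' k' :: nat
    assume "i < j" "j < k" "i' < j'" "j' < k'"
      and eq: "{(i, j), (j, k), (i, k)} = {(i', j'), (j', k'), (i', k')}"
    moreover have "(i, j) \<in> {(i', j'), (j', k'), (i', k')}" "(j, k) \<in> {(i', j'), (j', k'), (i', k')}"
      unfolding eq[symmetric] by simp_all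
    ultimately show "i = i' \<and> j = j' \<and> k = k'" by (elim insertE emptyE) auto
  qed
  moreover have "?g ` ?T = {F \<in> Pow (edges_of r EH). \<exists>i j k. i < j \<and> j < k \<and> F = {(i, j), (j, k), (i, k)}}"
  proof (intro equalityI subsetI)
    fix F assume "F \<in> {F \<in> Pow (edges_of r EH). \<exists>i j k. i < j \<and> j < k \<and> F = {(i, j), (j, k), (i, k)}}"
    then obtain i j k where "i < j" "j < k" "F = {(i, j), (j, k), (i, k)}" "F \<subseteq> edges_of r EH" by blast
    then have "F = ?g (i, j, k)" "(i, j, k) \<in> ?T" by (auto simp: edges_of_def)
    then show "F \<in> ?g ` ?T" by (rule image_eqI)
  qed (auto simp: edges_of_def)
  ultimately show ?thesis unfolding num_triangles_def using card_image[of ?g ?T] by simp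
qed

text \<open>The subgraphs are grouped by their set \<open>U\<close> of non-isolated vertices. Each
  \<open>U\<close> admits at most \<open>2 ^ (card U choose 2)\<close> edge sets, and there are at
  most \<open>2 ^ r\<close> choices of \<open>U\<close>.\<close>

lemma (in small_codegree) sum_large_subgraphs_le:
  assumes H: "H \<subseteq> upper_pairs {0..<r}" and R: "R = 2 * r" and p: "0 < p" "p < 1"
    and \<nu>_small: "\<nu> \<le> (p / 8) powr (12 * real r)"
  shows "(\<Sum>F\<in>{F \<in> Pow H. 3 \<le> card F \<and> 4 \<le> card (verts F)}. \<bar>sub_density r F V f\<bar> / p ^ card F)
    \<le> 2 powr (- 2 * real r) * \<nu> powr (7 / 6)"
proof -
  let ?S = "{F \<in> Pow H. 3 \<le> card F \<and> 4 \<le> card (verts F)}"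
  let ?T = "{U \<in> Pow {0..<r}. 4 \<le> card U}"
  let ?h = "\<lambda>F. \<bar>sub_density r F V f\<bar> / p ^ card F"
  let ?C = "(1 + 5 * real r) * \<nu> powr (7 / 6)"
  have finH: "finite H" using finite_subset[OF H] finite_upper_pairs by blast
  have inner: "sum ?h {F \<in> ?S. verts F = U} \<le> ?C * (2 powr (- 4 * real r) / 4)" if U: "U \<in> ?T" for U
  proof -
    let ?c = "card U choose 2"
    have finU: "finite U" using U finite_subset by auto
    have ur: "card U \<le> r" using U card_mono[of "{0..<r}" U] by auto
    have sub: "F \<subseteq> upper_pairs U" if "F \<in> ?S" "verts F = U" for F
      using subset_upper_pairs_verts[of F "{0..<r}"] H that by auto
    have weight: "?h F \<le> (1 + 5 * real r) * \<nu> powr (7 / 6 + real (card U) / 24) / p ^ ?c"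
      if F: "F \<in> ?S" "verts F = U" for F
    proof (intro frac_le)
      show "\<bar>sub_density r F V f\<bar> \<le> (1 + 5 * real r) * \<nu> powr (7 / 6 + real (card U) / 24)"
        using sub_density_abs_le[of F r] F H R by auto
      have "card F \<le> ?c"
        using card_mono[OF finite_upper_pairs[OF finU] sub[OF F]] card_upper_pairs[OF finU] by simp
      then show "p ^ ?c \<le> p ^ card F" using p by (intro power_decreasing) auto
    qed (use p in auto)
    have "card {F \<in> ?S. verts F = U} \<le> card (Pow (upper_pairs U))"
      using sub finite_upper_pairs[OF finU] by (intro card_mono) auto
    then have "card {F \<in> ?S. verts F = U} \<le> 2 ^ ?c"
      using card_Pow[OF finite_upper_pairs[OF finU]] card_upper_pairs[OF finU] by simp
    from of_nat_mono[OF this, where 'a = real] have card: "real (card {F \<in> ?S. verts F = U}) \<le> 2 ^ ?c" by simp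
    have "sum ?h {F \<in> ?S. verts F = U} \<le> real (card {F \<in> ?S. verts F = U})
        * ((1 + 5 * real r) * \<nu> powr (7 / 6 + real (card U) / 24) / p ^ ?c)"
      using weight by (intro sum_bounded_above) auto
    also have "\<dots> \<le> 2 ^ ?c * ((1 + 5 * real r) * \<nu> powr (7 / 6 + real (card U) / 24) / p ^ ?c)"
      using card p by (intro mult_right_mono) auto
    also have "\<dots> = ?C * ((2 / p) ^ ?c * \<nu> powr (real (card U) / 24))"
      by (simp add: powr_add power_divide)
    also have "\<dots> \<le> ?C * (2 powr (- 4 * real r) / 4)"
      using U ur p \<nu>_pos \<nu>_small by (intro mult_left_mono graph_weight_le) auto
    finally show ?thesis .
  qed
  have "sum ?h ?S = (\<Sum>U\<in>?T. sum ?h {F \<in> ?S. verts F = U})"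
    using finH verts_subset[OF subset_trans[OF _ H]] by (intro sum.group[symmetric]) auto
  also have "\<dots> \<le> real (card ?T) * (?C * (2 powr (- 4 * real r) / 4))"
    using inner by (intro sum_bounded_above)
  also have "\<dots> \<le> 2 ^ r * (?C * (2 powr (- 4 * real r) / 4))"
  proof (intro mult_right_mono)
    have "card ?T \<le> card (Pow {0..<r})" by (intro card_mono) auto
    then have "card ?T \<le> 2 ^ r" by (simp add: card_Pow)
    from of_nat_mono[OF this, where 'a = real] show "real (card ?T) \<le> 2 ^ r" by simp
  qed auto
  also have "\<dots> = (1 + 5 * real r) * (2 ^ r * 2 powr (- 4 * real r) / 4 * \<nu> powr (7 / 6))" by simp
  \<comment> \<open>Of the factor \<open>2 powr (- 4 * real r) / 4\<close>, one \<open>2 ^ r\<close>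
    pays for the choices of \<open>U\<close> and \<open>4 * 2 ^ r\<close> for
    \<open>1 + 5 * real r\<close>.\<close>
  also have "\<dots> \<le> (4 * 2 ^ r) * (2 ^ r * 2 powr (- 4 * real r) / 4 * \<nu> powr (7 / 6))"
    by (intro mult_right_mono five_mult_le_two_power) auto
  also have "\<dots> = 2 powr real r * 2 powr real r * 2 powr (- 4 * real r) * \<nu> powr (7 / 6)"
    by (simp add: powr_realpow)
  also have "\<dots> = 2 powr (- 2 * real r) * \<nu> powr (7 / 6)"
    unfolding powr_add[symmetric] by simp
  finally show ?thesis .
qed

text \<open>The subsets of \<open>H\<close> fall into five classes: empty, one edge, two edges,
  triangles, and at least three edges on at least four vertices. The first, second and fourth cancel
  the subtracted terms exactly; the third and fifth give the two error terms.\<close>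

lemma (in small_codegree) subgraph_expansion_le:
  assumes H: "H \<subseteq> upper_pairs {0..<r}" and R: "R = 2 * r" and p: "0 < p" "p < 1"
    and \<nu>_small: "\<nu> \<le> (p / 8) powr (12 * real r)"
    and \<mu>: "\<And>x. x \<in> V \<Longrightarrow> \<bar>avg V (f x)\<bar> \<le> \<mu>"
  defines "T \<equiv> {F \<in> Pow H. \<exists>i j k. i < j \<and> j < k \<and> F = {(i, j), (j, k), (i, k)}}"
  shows "\<bar>(\<Sum>F\<in>Pow H. sub_density r F V f / p ^ card F) - 1
      - real (card H) * sub_density 2 {(0, 1)} V f / p
      - real (card T) * sub_density 3 {(0, 1), (1, 2), (0, 2)} V f / p ^ 3\<bar>
    \<le> 2 powr (- 2 * real r) * \<nu> powr (7 / 6) + 3 * real ((r + 1) choose 4) * \<mu>\<^sup>2 / p\<^sup>2"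
proof -
  let ?w = "\<lambda>F. sub_density r F V f / p ^ card F"
  let ?A1 = "(\<lambda>e. {e}) ` H" and ?A2 = "{F. F \<subseteq> H \<and> card F = 2}"
  let ?S = "{F \<in> Pow H. 3 \<le> card F \<and> 4 \<le> card (verts F)}"
  have finH: "finite H" using finite_subset[OF H] finite_upper_pairs by blast
  have finA: "finite ?A1" "finite ?A2" "finite T" "finite ?S" using finH by (auto simp: T_def)
  have T: "card F = 3 \<and> card (verts F) = 3" if F: "F \<in> T" for F
  proof -
    obtain i j k where ijk: "i < j" "j < k" "F = {(i, j), (j, k), (i, k)}"
      using F unfolding T_def by blast
    have "verts F = {i, j, k}" by (auto simp: verts_def ijk(3))
    then show ?thesis using ijk by simp
  qed
  have Pow_eq: "Pow H = {{}} \<union> ?A1 \<union> ?A2 \<union> T \<union> ?S"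
  proof (intro equalityI subsetI)
    fix F assume "F \<in> Pow H"
    then have F: "F \<subseteq> H" by simp
    consider "card F = 0" | "card F = 1" | "card F = 2" | "3 \<le> card F" "card (verts F) \<le> 3"
      | "3 \<le> card F" "4 \<le> card (verts F)" by linarith
    then show "F \<in> {{}} \<union> ?A1 \<union> ?A2 \<union> T \<union> ?S"
    proof cases
      case 2
      then obtain e where "F = {e}" by (rule card_1_singletonE)
      then show ?thesis using F by auto
    next
      case 4
      have "F \<in> T"
        unfolding T_def using triangle_of_card[OF subset_trans[OF F H] _ 4] F by simp
      then show ?thesis by simp
    qed (use F finite_subset[OF F finH] in auto)
  qed (auto simp: T_def)
  have disj: "{{}} \<inter> ?A1 = {}" "({{}} \<union> ?A1) \<inter> ?A2 = {}" "({{}} \<union> ?A1 \<union> ?A2) \<inter> T = {}"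
    "({{}} \<union> ?A1 \<union> ?A2 \<union> T) \<inter> ?S = {}"
    by (auto dest: T)
  have fin: "finite {{}}" "finite ({{}} \<union> ?A1)" "finite ({{}} \<union> ?A1 \<union> ?A2)"
    "finite ({{}} \<union> ?A1 \<union> ?A2 \<union> T)"
    using finA by simp_all
  have "sum ?w (Pow H) = sum ?w ({{}} \<union> ?A1 \<union> ?A2 \<union> T \<union> ?S)"
    using Pow_eq by (rule arg_cong)
  also have "\<dots> = ?w {} + sum ?w ?A1 + sum ?w ?A2 + sum ?w T + sum ?w ?S"
    unfolding sum.union_disjoint[OF fin(4) finA(4) disj(4)] sum.union_disjoint[OF fin(3) finA(3) disj(3)]
      sum.union_disjoint[OF fin(2) finA(2) disj(2)] sum.union_disjoint[OF fin(1) finA(1) disj(1)]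
    by simp
  finally have split: "sum ?w (Pow H) = ?w {} + sum ?w ?A1 + sum ?w ?A2 + sum ?w T + sum ?w ?S" .
  have empty: "?w {} = 1"
    using finite_V V_nonempty
    by (simp add: sub_density_def edge_prod_def[abs_def] avg_const finite_PiE PiE_eq_empty_iff)
  have edge: "?w {e} = sub_density 2 {(0, 1)} V f / p" if "e \<in> H" for e
    using that H sub_density_edge[OF finite_V V_nonempty, of "fst e" "snd e" r f]
      sub_density_edge[OF finite_V V_nonempty, of 0 1 2 f]
    by (auto simp: upper_pairs_def)
  have A1: "sum ?w ?A1 = real (card H) * sub_density 2 {(0, 1)} V f / p"
  proof -
    have "sum ?w ?A1 = (\<Sum>e\<in>H. ?w {e})" by (subst sum.reindex) (auto simp: inj_on_def)
    also have "\<dots> = (\<Sum>e\<in>H. sub_density 2 {(0, 1)} V f / p)" by (intro sum.cong refl edge)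
    finally show ?thesis by simp
  qed
  have tri: "?w F = sub_density 3 {(0, 1), (1, 2), (0, 2)} V f / p ^ 3" if F: "F \<in> T" for F
  proof -
    obtain i j k where ijk: "i < j" "j < k" "F = {(i, j), (j, k), (i, k)}" "F \<subseteq> H"
      using F unfolding T_def by blast
    then have "k < r" using H by (auto simp: upper_pairs_def)
    then show ?thesis
      using ijk(3) T[OF F] sub_density_triangle[OF finite_V V_nonempty ijk(1,2), of r f]
        sub_density_triangle[OF finite_V V_nonempty, of 0 1 2 3 f] by simp
  qed
  have AT: "sum ?w T = real (card T) * sub_density 3 {(0, 1), (1, 2), (0, 2)} V f / p ^ 3"
  proof -
    have "sum ?w T = (\<Sum>F\<in>T. sub_density 3 {(0, 1), (1, 2), (0, 2)} V f / p ^ 3)"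
      by (intro sum.cong refl tri)
    then show ?thesis by simp
  qed
  have A2: "\<bar>sum ?w ?A2\<bar> \<le> 3 * real ((r + 1) choose 4) * \<mu>\<^sup>2 / p\<^sup>2"
  proof -
    have "\<bar>sum ?w ?A2\<bar> \<le> (\<Sum>F\<in>?A2. \<bar>?w F\<bar>)" by (rule sum_abs)
    also have "\<dots> \<le> real (card ?A2) * (\<mu>\<^sup>2 / p\<^sup>2)"
    proof (rule sum_bounded_above)
      fix F assume F: "F \<in> ?A2"
      then have "\<bar>sub_density r F V f\<bar> \<le> \<mu>\<^sup>2"
        using H by (intro sub_density_two_edges_le \<mu>) auto
      then show "\<bar>?w F\<bar> \<le> \<mu>\<^sup>2 / p\<^sup>2" using F p by (simp add: abs_divide divide_right_mono)
    qed
    also have "\<dots> \<le> real ((r choose 2) choose 2) * (\<mu>\<^sup>2 / p\<^sup>2)"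
    proof (intro mult_right_mono)
      have "card H \<le> r choose 2"
        using card_mono[OF finite_upper_pairs H] card_upper_pairs[of "{0..<r}"] by simp
      then show "real (card ?A2) \<le> real ((r choose 2) choose 2)"
        using n_subsets[OF finH, of 2] by (simp add: binomial_right_mono)
    qed auto
    finally show ?thesis unfolding choose_two_choose_two by simp
  qed
  have AS: "\<bar>sum ?w ?S\<bar> \<le> 2 powr (- 2 * real r) * \<nu> powr (7 / 6)"
  proof -
    have "\<bar>sum ?w ?S\<bar> \<le> (\<Sum>F\<in>?S. \<bar>?w F\<bar>)" by (rule sum_abs)
    also have "\<dots> = (\<Sum>F\<in>?S. \<bar>sub_density r F V f\<bar> / p ^ card F)"
      using p by (simp add: abs_divide)
    also have "\<dots> \<le> 2 powr (- 2 * real r) * \<nu> powr (7 / 6)"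
      by (intro sum_large_subgraphs_le H R p \<nu>_small)
    finally show ?thesis .
  qed
  show ?thesis using A2 AS unfolding split empty A1 AT by linarith
qed

section \<open>Application to graphs\<close>

lemma hom_density_complete:
  "hom_density 2 complete_graph V W = sub_density 2 {(0, 1)} V W"
  "hom_density 3 complete_graph V W = sub_density 3 {(0, 1), (1, 2), (0, 2)} V W"
proof -
  have "edges_of 2 complete_graph = {(0, 1)}" "edges_of 3 complete_graph = {(0, 1), (1, 2), (0, 2)}"
    by (auto simp: edges_of_def complete_graph_def)
  then show "hom_density 2 complete_graph V W = sub_density 2 {(0, 1)} V W"
    "hom_density 3 complete_graph V W = sub_density 3 {(0, 1), (1, 2), (0, 2)} V W"
    by (simp_all add: hom_density_eq_sub_density)
qed

lemma f_graph_small_codegree: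
  assumes G: "simple_graph V E" and Vne: "V \<noteq> {}" and p: "0 < p" "p < 1"
    and \<nu>: "0 < \<nu>" "nu_graph p V E \<le> \<nu>" "\<nu> \<le> 1" and card: "1 / real (card V) \<le> \<nu> ^ R"
  shows "small_codegree V (f_graph p E) \<nu> R"
proof
  show fin: "finite V" using G by (simp add: simple_graph_def)
  show sym: "f_graph p E x y = f_graph p E y x" for x y
    using G by (auto simp: simple_graph_def f_graph_def W_graph_def)
  show "\<bar>f_graph p E x y\<bar> \<le> 1" for x y
    using p by (simp add: f_graph_def W_graph_def)
  fix x y assume xy: "x \<in> V" "y \<in> V" "x \<noteq> y"
  let ?M = "{max 0 (avg V (\<lambda>z. f_graph p E x z * f_graph p E z y)) | x y. x \<in> V \<and> y \<in> V \<and> x \<noteq> y}"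
  have "?M \<subseteq> (\<lambda>(x, y). max 0 (avg V (\<lambda>z. f_graph p E x z * f_graph p E z y))) ` (V \<times> V)"
    by auto
  then have "finite ?M" using fin by (meson finite_SigmaI finite_imageI finite_subset)
  then have "max 0 (avg V (\<lambda>z. f_graph p E x z * f_graph p E z y)) \<le> nu_graph p V E"
    unfolding nu_graph_def using xy by (intro Max_ge) auto
  then show "codeg V (f_graph p E) x y \<le> \<nu>"
    using \<nu>(2) by (simp add: codeg_def sym[of y])
qed (use assms in auto)

theorem theorem3p7:
  fixes V :: "'a set" and E :: "'a \<Rightarrow> 'a \<Rightarrow> bool"
    and r :: nat and EH :: "nat \<Rightarrow> nat \<Rightarrow> bool" and p \<nu> :: real
  assumes G: "simple_graph V E" and Vne: "V \<noteq> {}"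
    and H: "simple_graph {0..<r} EH"
    and p: "0 < p" "p < 1"
    and \<nu>pos: "0 < \<nu>"
    and \<nu>: "nu_graph p V E \<le> \<nu>" "\<nu> \<le> 1"
    and r_bound: "real r \<le> ln (1 / \<nu>) / (12 * ln (8 / p))"
    and n_bound: "\<nu> powr (- 2 * real r) \<le> real (card V)"
  shows "\<bar>hom_density r EH V (W_graph E) / p ^ num_edges r EH - 1
           - real (num_edges r EH) * hom_density 2 complete_graph V (f_graph p E) / p
           - real (num_triangles r EH) * hom_density 3 complete_graph V (f_graph p E) / p ^ 3\<bar>
         \<le> 2 powr (- 2 * real r) * \<nu> powr (7 / 6)
           + 3 * real ((r + 1) choose 4) * mu_graph p V E ^ 2 / p ^ 2"
proof -
  have finV: "finite V" using G by (simp add: simple_graph_def)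
  have "0 < real (card V)" using finV Vne by (simp add: card_gt_0_iff)
  \<comment> \<open>The lower bound on the number of vertices becomes the assumption
    \<open>card_ge\<close> with \<open>R = 2 * r\<close>.\<close>
  have "1 / real (card V) \<le> 1 / \<nu> powr (- 2 * real r)"
    using n_bound \<nu>pos by (intro divide_left_mono mult_pos_pos \<open>0 < real (card V)\<close>) auto
  also have "\<dots> = \<nu> powr real (2 * r)" by (simp add: powr_minus_divide)
  also have "\<dots> = \<nu> ^ (2 * r)" using \<nu>pos by (rule powr_realpow)
  finally interpret small_codegree V "f_graph p E" \<nu> "2 * r"
    using f_graph_small_codegree[OF G Vne p \<nu>pos \<nu>] by blast
  \<comment> \<open>Clearing this positive denominator and exponentiating turns the bound on
    \<open>r\<close> into an upper bound for \<nu>.\<close>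
  have "0 < ln (8 / p)" using p by (intro ln_gt_zero) auto
  then have "12 * real r * ln (8 / p) \<le> ln (1 / \<nu>)"
    using r_bound by (simp add: pos_le_divide_eq mult.commute mult.left_commute)
  then have "ln \<nu> \<le> 12 * real r * ln (p / 8)"
    using p \<nu>pos by (simp add: ln_div algebra_simps)
  then have "ln \<nu> \<le> ln ((p / 8) powr (12 * real r))"
    using p by (simp add: ln_powr)
  then have \<nu>_small: "\<nu> \<le> (p / 8) powr (12 * real r)"
    using p \<nu>pos by (subst (asm) ln_le_cancel_iff) auto
  have \<mu>: "\<bar>avg V (f_graph p E x)\<bar> \<le> mu_graph p V E" if "x \<in> V" for x
    unfolding mu_graph_def using that finV by (intro Max_ge) auto
  have W: "W_graph E = (\<lambda>x y. f_graph p E x y + p)" by (simp add: f_graph_def)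
  have "finite (edges_of r EH)" using finite_subset[OF edges_of_subset] finite_upper_pairs by blast
  then have "hom_density r EH V (W_graph E) / p ^ num_edges r EH
      = (\<Sum>F\<in>Pow (edges_of r EH). sub_density r F V (f_graph p E) / p ^ card F)"
    unfolding hom_density_eq_sub_density num_edges_def W using p by (intro sub_density_shift) auto
  then show ?thesis
    using subgraph_expansion_le[OF edges_of_subset refl p \<nu>_small \<mu>, of EH]
    by (simp add: hom_density_complete num_edges_def num_triangles_eq)
qed

end
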